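(* Let $y,z>0$, $p=y/(y+z)$, and let $$(A,B)\overset{d}{=}I_p(1-L,0)+(1-I_p)(1,R),$$ where $I_p\sim Be(p)$ is independent of the $[0,1)^2$-valued random vector $(L,R)$, with $L\sim\beta(1,y+z)$ and $R\sim\beta(y,z+1)$. Set $(a,b)=(z,1)$. Then all of the following hold. (i) For $V_2\sim\Gamma_b$, $V_1\sim\Gamma_a$ is the unique (in distribution) solution to $V_1\overset{d}{=}AV_1+BV_2$, where $V_1,V_2,(A,B)$ are mutually independent. (ii) $X\sim\beta(a,b)$ is the unique (in distribution) solution to $X\overset{d}{=}AX+B(1-X)$, where $X$ is independent of $(A,B)$. (iii) There is a random variable $Y\sim\beta(a,b)$ such that, as $n\to\infty$, $Y_n(x)\to Y$ almost surely, uniformly in $x\in[0,1]$. (iv) For every $x\in[0,1]$, $X_n(x)$ converges in distribution to $\beta(a,b)$ as $n\to\infty$. (v) For every $x'\in(0,\infty)$, $X'_n(x')$ converges in distribution to $\Gamma_a$ as $n\to\infty$.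
   Context: $\overset{d}{=}$ denotes equality in distribution. $Be(p)$ is the Bernoulli distribution with success probability $p$. $\beta(a,b)$, $a,b>0$, is the beta distribution with density $B(a,b)^{-1}u^{a-1}(1-u)^{b-1}$ on $(0,1)$. $\Gamma_a$, $a>0$, is the gamma distribution with shape $a$ and scale $1$. $F_1\otimes F_2$ denotes the joint law of independent random elements with laws $F_1$, $F_2$. A solution of a random equation is a real random variable (or its law) satisfying it; uniqueness is in distribution. No assumption is made on the dependence between $L$ and $R$. Let $\mu$ be the law of $(A,B)$ and let $(A_1,B_1,V_1),(A_2,B_2,V_2),\dots$ be i.i.d. with law $\mu\otimes\Gamma_b$. Put $F_n(x)=A_nx+B_n(1-x)$ for $x\in[0,1]$ and $G_n(x')=A_nx'+B_nV_n$ for $x'\in(0,\infty)$. Define, for $n\ge1$, $X_n=F_n\circ F_{n-1}\circ\cdots\circ F_1$ (forward iteration), $Y_n=F_1\circ F_2\circ\cdots\circ F_n$ (backward iteration), and $X'_n=G_n\circ G_{n-1}\circ\cdots\circ G_1$. *)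

theory Defs
  imports "HOL-Probability.Probability"
begin

definition beta_density :: "real \<Rightarrow> real \<Rightarrow> real \<Rightarrow> real" where
  "beta_density a b u =
     (if 0 < u \<and> u < 1 then u powr (a - 1) * (1 - u) powr (b - 1) / Beta a b else 0)"

definition beta_law :: "real \<Rightarrow> real \<Rightarrow> real measure" where
  "beta_law a b = density lborel (\<lambda>u. ennreal (beta_density a b u))"

definition gamma_density :: "real \<Rightarrow> real \<Rightarrow> real" where
  "gamma_density a v = (if 0 < v then v powr (a - 1) * exp (- v) / Gamma a else 0)"

definition gamma_law :: "real \<Rightarrow> real measure" where
  "gamma_law a = density lborel (\<lambda>v. ennreal (gamma_density a v))"

(* Independence is expressed by the joint law being the product of the marginal laws (cf.
   prob_space.indep_var_distribution_eq), because the library's indep_var only applies to two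
   random variables with values in the same type. *)
definition indep_rv ::
    "'w measure \<Rightarrow> 'a measure \<Rightarrow> ('w \<Rightarrow> 'a) \<Rightarrow> 'b measure \<Rightarrow> ('w \<Rightarrow> 'b) \<Rightarrow> bool" where
  "indep_rv M S X T Y \<longleftrightarrow>
     X \<in> measurable M S \<and> Y \<in> measurable M T \<and>
     distr M (S \<Otimes>\<^sub>M T) (\<lambda>\<omega>. (X \<omega>, Y \<omega>)) = distr M S X \<Otimes>\<^sub>M distr M T Y"

(* The random equations are stated for laws: \<nu> is the law of a real random variable V1 (resp. X),
   independence of the variables on the right-hand side is the product measure, and mu is the
   law of (A, B).  The lemmas below give the form in terms of random variables. *)
definition sum_equation_solution :: "(real \<times> real) measure \<Rightarrow> real \<Rightarrow> real measure \<Rightarrow> bool" where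
  "sum_equation_solution mu b \<nu> \<longleftrightarrow>
     real_distribution \<nu> \<and>
     distr (\<nu> \<Otimes>\<^sub>M (gamma_law b \<Otimes>\<^sub>M mu)) borel (\<lambda>(v1, v2, A, B). A * v1 + B * v2) = \<nu>"

definition mix_equation_solution :: "(real \<times> real) measure \<Rightarrow> real measure \<Rightarrow> bool" where
  "mix_equation_solution mu \<nu> \<longleftrightarrow>
     real_distribution \<nu> \<and>
     distr (\<nu> \<Otimes>\<^sub>M mu) borel (\<lambda>(x, A, B). A * x + B * (1 - x)) = \<nu>"

lemma sum_equation_solution_rv:
  fixes V1 V2 :: "'w \<Rightarrow> real" and AB :: "'w \<Rightarrow> real \<times> real"
  assumes "prob_space M"
    and V1: "indep_rv M borel V1 (borel \<Otimes>\<^sub>M borel) (\<lambda>\<omega>. (V2 \<omega>, AB \<omega>))"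
    and V2: "indep_rv M borel V2 borel AB"
    and "distr M borel V2 = gamma_law b"
  shows "sum_equation_solution (distr M borel AB) b (distr M borel V1) \<longleftrightarrow>
    distr M borel V1 = distr M borel (\<lambda>\<omega>. fst (AB \<omega>) * V1 \<omega> + snd (AB \<omega>) * V2 \<omega>)"
proof -
  interpret prob_space M by fact
  have [measurable]: "V1 \<in> borel_measurable M" "V2 \<in> borel_measurable M" "AB \<in> borel_measurable M"
    using V1 V2 by (auto simp: indep_rv_def)
  have "distr M borel V1 \<Otimes>\<^sub>M (gamma_law b \<Otimes>\<^sub>M distr M borel AB)
      = distr M (borel \<Otimes>\<^sub>M (borel \<Otimes>\<^sub>M borel)) (\<lambda>\<omega>. (V1 \<omega>, V2 \<omega>, AB \<omega>))"
    using V1 V2 assms(4) by (simp add: indep_rv_def)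
  moreover have "(\<lambda>(v1, v2, A, B). A * v1 + B * v2) \<in>
      borel_measurable (borel \<Otimes>\<^sub>M (borel \<Otimes>\<^sub>M (borel :: (real \<times> real) measure)))"
    by (auto simp: borel_prod split_beta' intro!: borel_measurable_continuous_onI continuous_intros)
  ultimately have "distr (distr M borel V1 \<Otimes>\<^sub>M (gamma_law b \<Otimes>\<^sub>M distr M borel AB)) borel
      (\<lambda>(v1, v2, A, B). A * v1 + B * v2)
      = distr M borel (\<lambda>\<omega>. fst (AB \<omega>) * V1 \<omega> + snd (AB \<omega>) * V2 \<omega>)"
    by (simp add: distr_distr comp_def split_beta')
  moreover have "real_distribution (distr M borel V1)"
    by simp
  ultimately show ?thesis
    by (auto simp: sum_equation_solution_def)
qed

lemma mix_equation_solution_rv: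
  fixes X :: "'w \<Rightarrow> real" and AB :: "'w \<Rightarrow> real \<times> real"
  assumes "prob_space M" and X: "indep_rv M borel X borel AB"
  shows "mix_equation_solution (distr M borel AB) (distr M borel X) \<longleftrightarrow>
    distr M borel X = distr M borel (\<lambda>\<omega>. fst (AB \<omega>) * X \<omega> + snd (AB \<omega>) * (1 - X \<omega>))"
proof -
  interpret prob_space M by fact
  have [measurable]: "X \<in> borel_measurable M" "AB \<in> borel_measurable M"
    using X by (auto simp: indep_rv_def)
  have "distr M borel X \<Otimes>\<^sub>M distr M borel AB = distr M (borel \<Otimes>\<^sub>M borel) (\<lambda>\<omega>. (X \<omega>, AB \<omega>))"
    using X by (simp add: indep_rv_def)
  moreover have "(\<lambda>(x, A, B). A * x + B * (1 - x)) \<in>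
      borel_measurable (borel \<Otimes>\<^sub>M (borel :: (real \<times> real) measure))"
    by (auto simp: borel_prod split_beta' intro!: borel_measurable_continuous_onI continuous_intros)
  ultimately have "distr (distr M borel X \<Otimes>\<^sub>M distr M borel AB) borel
      (\<lambda>(x, A, B). A * x + B * (1 - x))
      = distr M borel (\<lambda>\<omega>. fst (AB \<omega>) * X \<omega> + snd (AB \<omega>) * (1 - X \<omega>))"
    by (simp add: distr_distr comp_def split_beta')
  moreover have "real_distribution (distr M borel X)"
    by simp
  ultimately show ?thesis
    by (auto simp: mix_equation_solution_def)
qed

(* forward_iter f n = f n \<circ> \<dots> \<circ> f 1  and  backward_iter f n = f 1 \<circ> \<dots> \<circ> f n *)
primrec forward_iter :: "(nat \<Rightarrow> 'a \<Rightarrow> 'a) \<Rightarrow> nat \<Rightarrow> 'a \<Rightarrow> 'a" where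
  "forward_iter f 0 = id"
| "forward_iter f (Suc n) = f (Suc n) \<circ> forward_iter f n"

primrec backward_iter :: "(nat \<Rightarrow> 'a \<Rightarrow> 'a) \<Rightarrow> nat \<Rightarrow> 'a \<Rightarrow> 'a" where
  "backward_iter f 0 = id"
| "backward_iter f (Suc n) = backward_iter f n \<circ> f (Suc n)"

end

theory Submission
  imports Defs
begin

text \<open>
  Both equations have the form \<open>X =\<^sub>d C X + D\<close> with \<open>E \<bar>C\<bar> < 1\<close>: for the first one take
  \<open>(C, D) = (A, B V\<^sub>2)\<close>, for the second one \<open>(C, D) = (A - B, B)\<close>. The transition operator of such a
  random affine map shrinks Lipschitz constants by the factor \<open>E \<bar>C\<bar>\<close>, so its iterates on a bounded
  Lipschitz function become constant. Applied to the functions \<open>x \<mapsto> exp (i t x)\<close>, this gives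
  uniqueness of the invariant law and weak convergence to it. The expected length of the image of
  \<open>[0, 1]\<close> under the backward iteration decays geometrically, hence the almost sure limit.

  That \<open>\<beta>(z, 1)\<close> solves the second equation is seen from its distribution function \<open>t \<mapsto> t\<^sup>z\<close>. The first
  equation then follows from beta-gamma algebra: if \<open>X \<sim> \<beta>(z, 1)\<close> and \<open>S \<sim> \<Gamma>\<^sub>z\<^sub>+\<^sub>1\<close> are independent,
  then \<open>X S\<close> and \<open>(1 - X) S\<close> are independent with laws \<open>\<Gamma>\<^sub>z\<close> and \<open>\<Gamma>\<^sub>1\<close>, and
  \<open>A (X S) + B ((1 - X) S) = (A X + B (1 - X)) S\<close>.
\<close>

section \<open>Random affine maps\<close>

text \<open>Keeps the simplifier from rewriting the index sets \<open>{1..n}\<close> to \<open>{Suc 0..n}\<close>.\<close>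
declare One_nat_def [simp del]

text \<open>The noise space is abstract so that both equations, whose maps are different functions
  of the same noise \<open>((A, B), V)\<close>, become instances. The contraction is only in mean:
  single maps need not contract, as \<open>A = 1\<close> has positive probability in the
  application.\<close>

locale random_affine_map = prob_space K
  for K :: "'k::topological_space measure" +
  fixes c d :: "'k \<Rightarrow> real"
  assumes sets_K [measurable_cong]: "sets K = sets borel"
    and c_meas [measurable]: "c \<in> borel_measurable borel"
    and d_meas [measurable]: "d \<in> borel_measurable borel"
    and c_int: "integrable K c"
    and c_contr: "expectation (\<lambda>k. \<bar>c k\<bar>) < 1"
begin

text \<open>One step of the chain on laws; each random equation will read
  \<open>push \<nu> = \<nu>\<close>.\<close>

definition push :: "real measure \<Rightarrow> real measure" where
  "push \<nu> = distr (\<nu> \<Otimes>\<^sub>M K) borel (\<lambda>(x, k). c k * x + d k)"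

text \<open>The Markov transition operator on functions, dual to \<open>push\<close>.\<close>

definition avg :: "(real \<Rightarrow> complex) \<Rightarrow> real \<Rightarrow> complex" where
  "avg \<phi> x = expectation (\<lambda>k. \<phi> (c k * x + d k))"

abbreviation \<rho> :: real where "\<rho> \<equiv> expectation (\<lambda>k. \<bar>c k\<bar>)"

text \<open>The Lipschitz constant is a parameter because its decay under \<open>avg\<close> drives
  everything; the bound 1 serves dominated convergence, and complex values admit
  \<open>x \<mapsto> exp (i t x)\<close>.\<close>

definition test_fun :: "real \<Rightarrow> (real \<Rightarrow> complex) \<Rightarrow> bool" where
  "test_fun C \<phi> \<longleftrightarrow> C-lipschitz_on UNIV \<phi> \<and> (\<forall>x. norm (\<phi> x) \<le> 1)"

lemma test_fun_norm: "test_fun C \<phi> \<Longrightarrow> norm (\<phi> x) \<le> 1"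
  by (simp add: test_fun_def)

lemma test_fun_measurable: "test_fun C \<phi> \<Longrightarrow> \<phi> \<in> borel_measurable borel"
  unfolding test_fun_def
  by (intro borel_measurable_continuous_onI lipschitz_on_continuous_on) auto

lemma test_fun_diff: "test_fun C \<phi> \<Longrightarrow> norm (\<phi> x - \<phi> x') \<le> C * \<bar>x - x'\<bar>"
  by (auto simp: test_fun_def lipschitz_on_def dist_norm)

text \<open>Factoring out \<open>exp (i t x')\<close>, which has modulus 1, leaves
  \<open>|exp (i u) - 1| \<le> |u|\<close> with \<open>u = t (x - x')\<close>; this is the Taylor
  bound of order 0.\<close>

lemma test_fun_iexp: "test_fun \<bar>t\<bar> (\<lambda>x. iexp (t * x))"
proof -
  have "norm (iexp (t * x) - iexp (t * x')) \<le> \<bar>t\<bar> * \<bar>x - x'\<bar>" for x x' :: real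
  proof -
    have "iexp (t * x) - iexp (t * x') = iexp (t * x') * (iexp (t * (x - x')) - 1)"
      by (simp add: algebra_simps flip: exp_add)
    then have "norm (iexp (t * x) - iexp (t * x')) = norm (iexp (t * (x - x')) - 1)"
      by (simp add: norm_mult del: of_real_mult)
    also have "\<dots> \<le> \<bar>t * (x - x')\<bar>"
      using iexp_approx1[of "t * (x - x')" 0] by simp
    finally show ?thesis by (simp add: abs_mult)
  qed
  then show ?thesis
    by (auto simp: test_fun_def lipschitz_on_def dist_norm simp del: of_real_mult)
qed

lemma integrable_test_fun:
  assumes "test_fun C \<phi>" "prob_space P" "f \<in> borel_measurable P"
  shows "integrable P (\<lambda>w. \<phi> (f w))"
proof -
  interpret P: prob_space P by fact
  note test_fun_measurable[OF assms(1), measurable] and assms(3)[measurable]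
  show ?thesis
    by (rule P.integrable_const_bound[where B = 1]) (auto simp: test_fun_norm[OF assms(1)])
qed

text \<open>Coupling: the same noise \<open>k\<close> moves both points, so their distance is
  multiplied by \<open>|c k|\<close>, whose mean is \<open>\<rho>\<close>.\<close>

lemma test_fun_avg:
  assumes \<phi>: "test_fun C \<phi>"
  shows "test_fun (C * \<rho>) (avg \<phi>)"
proof -
  have C: "0 \<le> C"
    using \<phi> by (auto simp: test_fun_def lipschitz_on_def)
  have int: "integrable K (\<lambda>k. \<phi> (c k * x + d k))" for x
    by (rule integrable_test_fun[OF \<phi>]) (auto intro: prob_space_axioms)
  have "norm (avg \<phi> x - avg \<phi> x') \<le> C * \<rho> * \<bar>x - x'\<bar>" for x x'
  proof -
    have "avg \<phi> x - avg \<phi> x' = expectation (\<lambda>k. \<phi> (c k * x + d k) - \<phi> (c k * x' + d k))"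
      unfolding avg_def by (simp add: int)
    also have "norm \<dots> \<le> expectation (\<lambda>k. norm (\<phi> (c k * x + d k) - \<phi> (c k * x' + d k)))"
      by (rule integral_norm_bound)
    also have "\<dots> \<le> expectation (\<lambda>k. C * \<bar>x - x'\<bar> * \<bar>c k\<bar>)"
    proof (rule integral_mono)
      show "norm (\<phi> (c k * x + d k) - \<phi> (c k * x' + d k)) \<le> C * \<bar>x - x'\<bar> * \<bar>c k\<bar>" for k
        using test_fun_diff[OF \<phi>, of "c k * x + d k" "c k * x' + d k"]
        by (simp add: mult.assoc flip: abs_mult right_diff_distrib)
           (simp add: mult.commute)
    qed (use int c_int in auto)
    finally show ?thesis by (simp add: mult_ac)
  qed
  moreover have "norm (avg \<phi> x) \<le> 1" for x
  proof -
    have "norm (avg \<phi> x) \<le> expectation (\<lambda>k. norm (\<phi> (c k * x + d k)))"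
      unfolding avg_def by (rule integral_norm_bound)
    also have "\<dots> \<le> expectation (\<lambda>k. 1)"
      by (rule integral_mono) (use int test_fun_norm[OF \<phi>] in auto)
    finally show ?thesis by (simp add: prob_space)
  qed
  ultimately show ?thesis
    using C by (auto simp: test_fun_def lipschitz_on_def dist_norm)
qed

lemma test_fun_avg_funpow: "test_fun C \<phi> \<Longrightarrow> test_fun (C * \<rho> ^ n) ((avg ^^ n) \<phi>)"
proof (induction n)
  case (Suc n)
  from test_fun_avg[OF Suc.IH[OF Suc.prems]] show ?case
    by (simp add: mult_ac)
qed simp

lemma integral_push:
  assumes \<phi>: "test_fun C \<phi>" and \<nu>: "real_distribution \<nu>"
  shows "integral\<^sup>L (push \<nu>) \<phi> = integral\<^sup>L \<nu> (avg \<phi>)"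
proof -
  interpret \<nu>: real_distribution \<nu> by fact
  interpret pair_prob_space \<nu> K ..
  note test_fun_measurable[OF \<phi>, measurable]
  have "integral\<^sup>L (push \<nu>) \<phi> = (\<integral>(x, k). \<phi> (c k * x + d k) \<partial>(\<nu> \<Otimes>\<^sub>M K))"
    unfolding push_def by (subst integral_distr) (auto simp: split_beta')
  also have "\<dots> = integral\<^sup>L \<nu> (avg \<phi>)"
  proof -
    have "integrable (\<nu> \<Otimes>\<^sub>M K) (\<lambda>w. \<phi> (c (snd w) * fst w + d (snd w)))"
      by (rule integrable_test_fun[OF \<phi>]) (auto intro: prob_space_axioms)
    then show ?thesis
      unfolding avg_def by (subst integral_fst[symmetric]) (auto simp: split_beta')
  qed
  finally show ?thesis .
qed

section \<open>Invariant laws: ergodicity and uniqueness\<close>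

context
  fixes \<nu>
  assumes real_dist: "real_distribution \<nu>" and fixed: "push \<nu> = \<nu>"
begin

lemma integral_avg_funpow:
  "test_fun C \<phi> \<Longrightarrow> integral\<^sup>L \<nu> ((avg ^^ n) \<phi>) = integral\<^sup>L \<nu> \<phi>"
  by (induction n) (use integral_push[OF test_fun_avg_funpow real_dist] fixed in auto)

text \<open>The iterates flatten out while their \<open>\<nu>\<close>-integral stays fixed by
  invariance, so the limiting constant must be that integral. The starting point \<open>x\<close> is
  arbitrary.\<close>

lemma avg_funpow_tendsto:
  assumes \<phi>: "test_fun C \<phi>"
  shows "(\<lambda>n. (avg ^^ n) \<phi> x) \<longlonglongrightarrow> integral\<^sup>L \<nu> \<phi>"
proof -
  interpret \<nu>: real_distribution \<nu> by (rule real_dist)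
  have [measurable]: "(avg ^^ n) \<phi> \<in> borel_measurable borel" for n
    by (rule test_fun_measurable[OF test_fun_avg_funpow[OF \<phi>]])
  note norm_le = test_fun_norm[OF test_fun_avg_funpow[OF \<phi>]]
  have int: "integrable \<nu> ((avg ^^ n) \<phi>)" for n
    using integrable_test_fun[OF test_fun_avg_funpow[OF \<phi>], of \<nu> "\<lambda>x. x" n] \<nu>.prob_space_axioms
    by simp
  have "(\<lambda>n. \<integral>x'. (avg ^^ n) \<phi> x' - (avg ^^ n) \<phi> x \<partial>\<nu>) \<longlonglongrightarrow> (\<integral>x'. 0 \<partial>\<nu>)"
  \<comment> \<open>Integrating the Lipschitz bound \<open>C \<rho>^n |x' - x|\<close> over
    \<open>x'\<close> would require a first moment of \<open>\<nu>\<close>. It is used only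
    pointwise, with the constant 2 as dominating function, so that uniqueness holds among all real
    laws.\<close>
  proof (rule integral_dominated_convergence[where w = "\<lambda>_. 2"])
    show "AE x' in \<nu>. (\<lambda>n. (avg ^^ n) \<phi> x' - (avg ^^ n) \<phi> x) \<longlonglongrightarrow> 0"
    proof (intro AE_I2)
      fix x'
      have "(\<lambda>n. C * \<rho> ^ n * \<bar>x' - x\<bar>) \<longlonglongrightarrow> C * 0 * \<bar>x' - x\<bar>"
        by (intro tendsto_intros LIMSEQ_power_zero) (use c_contr in auto)
      then have "(\<lambda>n. C * \<rho> ^ n * \<bar>x' - x\<bar>) \<longlonglongrightarrow> 0" by simp
      then show "(\<lambda>n. (avg ^^ n) \<phi> x' - (avg ^^ n) \<phi> x) \<longlonglongrightarrow> 0"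
        by (rule Lim_null_comparison[rotated])
          (use test_fun_diff[OF test_fun_avg_funpow[OF \<phi>]] in auto)
    qed
    show "AE x' in \<nu>. norm ((avg ^^ n) \<phi> x' - (avg ^^ n) \<phi> x) \<le> 2" for n
      using norm_le[of n] norm_triangle_ineq4[of "(avg ^^ n) \<phi> _" "(avg ^^ n) \<phi> x"]
      by (intro AE_I2) (smt (verit, best))
  qed auto
  \<comment> \<open>Invariance evaluates the first integral, and total mass 1 evaluates the
    second.\<close>
  then have "(\<lambda>n. integral\<^sup>L \<nu> \<phi> - (avg ^^ n) \<phi> x) \<longlonglongrightarrow> 0"
    using \<nu>.prob_space by (simp add: int integral_avg_funpow[OF \<phi>])
  then have "(\<lambda>n. integral\<^sup>L \<nu> \<phi> - (integral\<^sup>L \<nu> \<phi> - (avg ^^ n) \<phi> x)) \<longlonglongrightarrow> integral\<^sup>L \<nu> \<phi> - 0"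
    by (intro tendsto_intros)
  then show ?thesis by simp
qed

end

text \<open>Both characteristic functions are limits of one and the same sequence, the iterates of
  \<open>avg\<close> at the point 0, which does not involve the invariant law.\<close>

lemma fixed_point_unique:
  assumes "real_distribution \<nu>" "push \<nu> = \<nu>" "real_distribution \<nu>'" "push \<nu>' = \<nu>'"
  shows "\<nu> = \<nu>'"
proof (rule Levy_uniqueness)
  show "char \<nu> = char \<nu>'"
  proof
    fix t
    show "char \<nu> t = char \<nu>' t"
      unfolding char_def
      by (rule LIMSEQ_unique[OF avg_funpow_tendsto[OF assms(1,2) test_fun_iexp]
            avg_funpow_tendsto[OF assms(3,4) test_fun_iexp, where x = 0]])
  qed
qed (use assms in auto)

end

section \<open>Iterates of i.i.d. random affine maps\<close>

locale random_affine_iteration = random_affine_map K c d + P: prob_space P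
  for K :: "'k::topological_space measure" and c d and P :: "'w measure" +
  fixes Z :: "nat \<Rightarrow> 'w \<Rightarrow> 'k"
  assumes indep: "P.indep_vars (\<lambda>_. borel) Z {1..}"
    and distr_Z: "\<And>n. n \<ge> 1 \<Longrightarrow> distr P borel (Z n) = K"
begin

definition step :: "(nat \<Rightarrow> 'k) \<Rightarrow> nat \<Rightarrow> real \<Rightarrow> real" where
  "step \<zeta> n x = c (\<zeta> n) * x + d (\<zeta> n)"

abbreviation X :: "'w \<Rightarrow> nat \<Rightarrow> real \<Rightarrow> real" where
  "X \<omega> n \<equiv> forward_iter (step (\<lambda>i. Z i \<omega>)) n"

abbreviation Y :: "'w \<Rightarrow> nat \<Rightarrow> real \<Rightarrow> real" where
  "Y \<omega> n \<equiv> backward_iter (step (\<lambda>i. Z i \<omega>)) n"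

lemma Z_meas: "n \<ge> 1 \<Longrightarrow> Z n \<in> borel_measurable P"
  using indep by (auto simp: P.indep_vars_def)

text \<open>The source \<open>S\<close> is general because the iterates are needed both as functions
  on \<open>P\<close> and as functions of a noise vector in a product space over
  \<open>{1..n}\<close>; only the indices from 1 to \<open>n\<close> are read.\<close>

lemma measurable_forward_iter:
  assumes "\<And>i. 1 \<le> i \<Longrightarrow> i \<le> n \<Longrightarrow> (\<lambda>s. W s i) \<in> borel_measurable S"
  shows "(\<lambda>s. forward_iter (step (W s)) n x) \<in> borel_measurable S"
  using assms
proof (induction n)
  case (Suc n)
  have [measurable]: "(\<lambda>s. W s (Suc n)) \<in> borel_measurable S"
    and [measurable]: "(\<lambda>s. forward_iter (step (W s)) n x) \<in> borel_measurable S"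
    using Suc by auto
  show ?case by (simp add: step_def[of _ "Suc n"])
qed simp

text \<open>The starting point \<open>g\<close> may vary with \<open>s\<close>: in the induction the
  innermost map is absorbed into it.\<close>

lemma measurable_backward_iter:
  assumes "\<And>i. 1 \<le> i \<Longrightarrow> i \<le> n \<Longrightarrow> (\<lambda>s. W s i) \<in> borel_measurable S"
    and "g \<in> borel_measurable S"
  shows "(\<lambda>s. backward_iter (step (W s)) n (g s)) \<in> borel_measurable S"
  using assms
proof (induction n arbitrary: g)
  case (Suc n)
  have [measurable]: "(\<lambda>s. W s (Suc n)) \<in> borel_measurable S" "g \<in> borel_measurable S"
    using Suc by auto
  show ?case
    unfolding backward_iter.simps comp_def
    by (rule Suc.IH) (use Suc.prems in \<open>auto simp: step_def\<close>)
qed simp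

text \<open>Makes the iterate a function of the finite vector \<open>(Z 1, ..., Z m)\<close>, to
  which independence applies.\<close>

lemma forward_iter_restrict:
  "n \<le> m \<Longrightarrow> forward_iter (step (restrict \<zeta> {1..m})) n = forward_iter (step \<zeta>) n"
  by (induction n) (auto simp: step_def fun_eq_iff)

lemma backward_iter_restrict:
  "n \<le> m \<Longrightarrow> backward_iter (step (restrict \<zeta> {1..m})) n = backward_iter (step \<zeta>) n"
  by (induction n) (auto simp: step_def fun_eq_iff)

definition past :: "nat \<Rightarrow> (nat \<Rightarrow> 'k) measure" where
  "past n = distr P (PiM {1..n} (\<lambda>_. borel)) (\<lambda>\<omega>. \<lambda>i\<in>{1..n}. Z i \<omega>)"

lemma past_meas [measurable]:
  "(\<lambda>\<omega>. \<lambda>i\<in>{1..n}. Z i \<omega>) \<in> measurable P (PiM {1..n} (\<lambda>_. borel))"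
  by (rule measurable_restrict) (use Z_meas in auto)

lemma prob_space_past: "prob_space (past n)"
  unfolding past_def by (rule P.prob_space_distr) simp

lemma sets_past [measurable_cong]: "sets (past n) = sets (PiM {1..n} (\<lambda>_. borel))"
  by (simp add: past_def)

text \<open>The index blocks \<open>{1..n}\<close> and \<open>{Suc n}\<close> are disjoint, hence
  independent as vectors. The second block is a vector with one entry, so evaluation at
  \<open>Suc n\<close> then replaces it by \<open>Z (Suc n)\<close>.\<close>

lemma distr_past_next:
  "distr P (PiM {1..n} (\<lambda>_. borel) \<Otimes>\<^sub>M borel) (\<lambda>\<omega>. (\<lambda>i\<in>{1..n}. Z i \<omega>, Z (Suc n) \<omega>)) = past n \<Otimes>\<^sub>M K"
proof -
  let ?Q = "PiM {1..n} (\<lambda>_. borel :: 'k measure)" and ?R = "PiM {Suc n} (\<lambda>_. borel :: 'k measure)"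
  let ?r = "\<lambda>\<omega>. \<lambda>i\<in>{1..n}. Z i \<omega>" and ?s = "\<lambda>\<omega>. \<lambda>i\<in>{Suc n}. Z i \<omega>"
  have [measurable]: "?s \<in> measurable P ?R"
    by (rule measurable_restrict) (use Z_meas in auto)
  have eval [measurable]: "(\<lambda>w. w (Suc n)) \<in> measurable ?R borel"
    by (rule measurable_component_singleton) simp
  have "P.indep_var ?Q ?r ?R ?s"
    by (rule P.indep_var_restrict[OF indep]) auto
  then have eq: "distr P (?Q \<Otimes>\<^sub>M ?R) (\<lambda>\<omega>. (?r \<omega>, ?s \<omega>)) = past n \<Otimes>\<^sub>M distr P ?R ?s"
    unfolding P.indep_var_distribution_eq past_def by simp
  have K: "distr (distr P ?R ?s) borel (\<lambda>w. w (Suc n)) = K"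
    by (subst distr_distr) (auto simp: comp_def distr_Z)
  have "past n \<Otimes>\<^sub>M K = distr (past n) ?Q (\<lambda>w. w) \<Otimes>\<^sub>M distr (distr P ?R ?s) borel (\<lambda>w. w (Suc n))"
    unfolding K by (subst distr_id2) (simp_all add: sets_past)
  also have "\<dots> = distr (past n \<Otimes>\<^sub>M distr P ?R ?s) (?Q \<Otimes>\<^sub>M borel) (\<lambda>(v, w). (v, w (Suc n)))"
    by (rule pair_measure_distr) (auto simp: K intro: prob_space_imp_sigma_finite prob_space_axioms)
  also have "\<dots> = distr P (?Q \<Otimes>\<^sub>M borel) (\<lambda>\<omega>. (?r \<omega>, Z (Suc n) \<omega>))"
    unfolding eq[symmetric] by (subst distr_distr) (auto simp: comp_def)
  finally show ?thesis ..
qed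

lemma integral_past_next:
  fixes h :: "(nat \<Rightarrow> 'k) \<times> 'k \<Rightarrow> complex"
  assumes [measurable]: "h \<in> borel_measurable (PiM {1..n} (\<lambda>_. borel) \<Otimes>\<^sub>M borel)"
  shows "P.expectation (\<lambda>\<omega>. h (\<lambda>i\<in>{1..n}. Z i \<omega>, Z (Suc n) \<omega>)) = integral\<^sup>L (past n \<Otimes>\<^sub>M K) h"
  unfolding distr_past_next[symmetric]
  by (rule integral_distr[symmetric]) (auto intro!: Z_meas measurable_Pair)

text \<open>The newest map acts last. Averaging over it with the past fixed turns
  \<open>\<phi>\<close> into \<open>avg \<phi>\<close>, so the induction must range over
  \<open>\<phi>\<close> and \<open>C\<close>.\<close>

lemma expectation_forward:
  assumes "test_fun C \<phi>"
  shows "P.expectation (\<lambda>\<omega>. \<phi> (X \<omega> n x)) = (avg ^^ n) \<phi> x"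
  using assms
proof (induction n arbitrary: C \<phi>)
  case 0
  then show ?case by (simp add: P.prob_space)
next
  case (Suc n)
  interpret Q: prob_space "past n" by (rule prob_space_past)
  interpret QK: pair_prob_space "past n" K ..
  note test_fun_measurable[OF Suc.prems, measurable]
  have [measurable]: "avg \<phi> \<in> borel_measurable borel"
    by (rule test_fun_measurable[OF test_fun_avg[OF Suc.prems]])
  have [measurable]:
    "(\<lambda>v. forward_iter (step v) n x) \<in> borel_measurable (PiM {1..n} (\<lambda>_. borel))"
    by (rule measurable_forward_iter) (auto intro!: measurable_component_singleton)
  let ?h = "\<lambda>(v, k). \<phi> (c k * forward_iter (step v) n x + d k)"
  have int: "integrable (past n \<Otimes>\<^sub>M K) ?h"
    using integrable_test_fun[OF Suc.prems QK.prob_space_axioms,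
        of "\<lambda>(v, k). c k * forward_iter (step v) n x + d k"]
    by (simp add: split_beta')
  have "P.expectation (\<lambda>\<omega>. \<phi> (X \<omega> (Suc n) x))
      = P.expectation (\<lambda>\<omega>. ?h (\<lambda>i\<in>{1..n}. Z i \<omega>, Z (Suc n) \<omega>))"
    by (simp add: step_def[of _ "Suc n"] forward_iter_restrict)
  also have "\<dots> = integral\<^sup>L (past n \<Otimes>\<^sub>M K) ?h"
    by (rule integral_past_next) simp
  also have "\<dots> = (\<integral>v. avg \<phi> (forward_iter (step v) n x) \<partial>past n)"
    unfolding avg_def by (rule QK.integral_fst[symmetric]) (use int in auto)
  also have "\<dots> = P.expectation (\<lambda>\<omega>. avg \<phi> (X \<omega> n x))"
    unfolding past_def by (subst integral_distr) (auto simp: forward_iter_restrict)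
  also have "\<dots> = (avg ^^ n) (avg \<phi>) x"
    by (rule Suc.IH[OF test_fun_avg[OF Suc.prems]])
  finally show ?case by (simp add: funpow_swap1)
qed

text \<open>Here the newest map acts first and only moves the starting point, so the induction
  ranges over \<open>x\<close> instead, and Fubini is used with the past integrated first.\<close>

lemma expectation_backward:
  assumes \<phi>: "test_fun C \<phi>"
  shows "P.expectation (\<lambda>\<omega>. \<phi> (Y \<omega> n x)) = (avg ^^ n) \<phi> x"
proof (induction n arbitrary: x)
  case 0
  then show ?case by (simp add: P.prob_space)
next
  case (Suc n)
  interpret Q: prob_space "past n" by (rule prob_space_past)
  interpret QK: pair_prob_space "past n" K ..
  note test_fun_measurable[OF \<phi>, measurable]
  have meas [measurable]:
    "(\<lambda>(v, k). backward_iter (step v) n (c k * x + d k))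
       \<in> borel_measurable (PiM {1..n} (\<lambda>_. borel) \<Otimes>\<^sub>M borel)"
    unfolding split_beta'
    by (rule measurable_backward_iter)
      (auto intro!: measurable_compose[OF measurable_fst] measurable_component_singleton)
  have [measurable]:
    "(\<lambda>v. backward_iter (step v) n x) \<in> borel_measurable (PiM {1..n} (\<lambda>_. borel))" for x
    by (rule measurable_backward_iter) (auto intro!: measurable_component_singleton)
  let ?h = "\<lambda>v k. \<phi> (backward_iter (step v) n (c k * x + d k))"
  have int: "integrable (past n \<Otimes>\<^sub>M K) (case_prod ?h)"
    using integrable_test_fun[OF \<phi> QK.prob_space_axioms,
        of "\<lambda>(v, k). backward_iter (step v) n (c k * x + d k)"] meas
    by (simp add: split_beta' cong: measurable_cong_sets)
  have meas': "case_prod ?h \<in> borel_measurable (PiM {1..n} (\<lambda>_. borel) \<Otimes>\<^sub>M borel)"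
    using measurable_compose[OF meas test_fun_measurable[OF \<phi>]] by (simp add: split_beta')
  have "P.expectation (\<lambda>\<omega>. \<phi> (Y \<omega> (Suc n) x))
      = P.expectation (\<lambda>\<omega>. case_prod ?h (\<lambda>i\<in>{1..n}. Z i \<omega>, Z (Suc n) \<omega>))"
    by (simp add: step_def[of _ "Suc n"] backward_iter_restrict)
  also have "\<dots> = integral\<^sup>L (past n \<Otimes>\<^sub>M K) (case_prod ?h)"
    by (rule integral_past_next[OF meas'])
  also have "\<dots> = expectation (\<lambda>k. \<integral>v. ?h v k \<partial>past n)"
    by (rule QK.integral_snd[symmetric]) (use int in auto)
  also have "\<dots> = expectation (\<lambda>k. P.expectation (\<lambda>\<omega>. \<phi> (Y \<omega> n (c k * x + d k))))"
    unfolding past_def by (subst integral_distr) (auto simp: backward_iter_restrict)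
  also have "\<dots> = (avg ^^ Suc n) \<phi> x"
    by (simp add: Suc.IH avg_def[of "(avg ^^ n) \<phi>"])
  finally show ?case .
qed

text \<open>By \<open>expectation_forward\<close> the characteristic functions are iterates of
  \<open>avg\<close> at \<open>x\<close>; they converge to that of the invariant law, and Levy
  continuity applies.\<close>

lemma forward_weak_conv:
  assumes "real_distribution \<nu>" "push \<nu> = \<nu>"
  shows "weak_conv_m (\<lambda>n. distr P borel (\<lambda>\<omega>. X \<omega> n x)) \<nu>"
proof (rule levy_continuity)
  have [measurable]: "(\<lambda>\<omega>. X \<omega> n x) \<in> borel_measurable P" for n
    by (rule measurable_forward_iter) (auto intro: Z_meas)
  show "real_distribution (distr P borel (\<lambda>\<omega>. X \<omega> n x))" for n
    by simp
  show "(\<lambda>n. char (distr P borel (\<lambda>\<omega>. X \<omega> n x)) t) \<longlonglongrightarrow> char \<nu> t" for t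
    unfolding char_def
    using avg_funpow_tendsto[OF assms test_fun_iexp, of t x]
    by (simp add: integral_distr expectation_forward[OF test_fun_iexp] del: of_real_mult)
qed fact

text \<open>Separates the start from the noise: uniform convergence on bounded sets reduces to
  convergence at 0 and to the slope tending to 0.\<close>

lemma backward_affine: "Y \<omega> n x = Y \<omega> n 0 + (\<Prod>i\<in>{1..n}. c (Z i \<omega>)) * x"
proof (induction n arbitrary: x)
  case (Suc n)
  show ?case
    unfolding backward_iter.simps comp_def
    by (subst Suc.IH, subst (2) Suc.IH) (simp add: step_def algebra_simps atLeastAtMostSuc_conv)
qed simp

text \<open>By independence the \<open>n\<close>-th term has mean \<open>\<rho>^n E|g|\<close>. The
  sum of the means is finite, so the random series is finite almost surely. It is used with
  \<open>g = d\<close> for the increments of the backward iteration at 0 and with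
  \<open>g = 1\<close> for its slopes.\<close>

lemma AE_summable_prod:
  fixes g :: "'k \<Rightarrow> real"
  assumes [measurable]: "g \<in> borel_measurable borel" and g: "integrable K g"
  shows "AE \<omega> in P. summable (\<lambda>n. \<bar>(\<Prod>i\<in>{1..n}. c (Z i \<omega>)) * g (Z (Suc n) \<omega>)\<bar>)"
proof -
  have [measurable]: "Z (Suc i) \<in> borel_measurable P" for i
    by (rule Z_meas) simp
  have [measurable]: "(\<lambda>\<omega>. \<Prod>i\<in>{1..n}. c (Z i \<omega>)) \<in> borel_measurable P" for n
    by (intro borel_measurable_prod measurable_compose[OF Z_meas c_meas]) auto
  have nn: "(\<integral>\<^sup>+\<omega>. ennreal \<bar>f (Z i \<omega>)\<bar> \<partial>P) = ennreal (expectation (\<lambda>k. \<bar>f k\<bar>))"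
    if "i \<ge> 1" "integrable K f" and [measurable]: "f \<in> borel_measurable borel" for f :: "'k \<Rightarrow> real" and i
  proof -
    have "(\<integral>\<^sup>+\<omega>. ennreal \<bar>f (Z i \<omega>)\<bar> \<partial>P) = (\<integral>\<^sup>+k. ennreal \<bar>f k\<bar> \<partial>distr P borel (Z i))"
      using Z_meas[OF \<open>i \<ge> 1\<close>] by (subst nn_integral_distr) auto
    also have "\<dots> = ennreal (expectation (\<lambda>k. \<bar>f k\<bar>))"
      unfolding distr_Z[OF \<open>i \<ge> 1\<close>] by (rule nn_integral_eq_integral) (use that in auto)
    finally show ?thesis .
  qed
  have nn_prod: "(\<integral>\<^sup>+\<omega>. ennreal \<bar>(\<Prod>i\<in>{1..n}. c (Z i \<omega>)) * g (Z (Suc n) \<omega>)\<bar> \<partial>P)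
      = ennreal (\<rho> ^ n * expectation (\<lambda>k. \<bar>g k\<bar>))" for n
  proof -
    \<comment> \<open>Treats the last factor \<open>g\<close> like the others, so that the whole
      term is one product over the independent family with indices
      \<open>{1..Suc n}\<close>.\<close>
    define h where "h i = (if i \<le> n then c else g)" for i
    have [measurable]: "h i \<in> borel_measurable borel" for i
      by (simp add: h_def)
    have h_int: "integrable K (h i)" for i
      using g c_int by (simp add: h_def)
    have "P.indep_vars (\<lambda>_. borel) Z {1..Suc n}"
      by (rule P.indep_vars_subset[OF indep]) auto
    then have ind: "P.indep_vars (\<lambda>_. borel) (\<lambda>i \<omega>. ennreal \<bar>h i (Z i \<omega>)\<bar>) {1..Suc n}"
      by (rule P.indep_vars_compose2) simp
    have "ennreal \<bar>(\<Prod>i\<in>{1..n}. c (Z i \<omega>)) * g (Z (Suc n) \<omega>)\<bar>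
        = (\<Prod>i\<in>{1..Suc n}. ennreal \<bar>h i (Z i \<omega>)\<bar>)" for \<omega>
    proof -
      have "\<bar>(\<Prod>i\<in>{1..n}. c (Z i \<omega>)) * g (Z (Suc n) \<omega>)\<bar> = (\<Prod>i\<in>{1..Suc n}. \<bar>h i (Z i \<omega>)\<bar>)"
        by (simp add: h_def abs_mult abs_prod mult.commute atLeastAtMostSuc_conv)
      then show ?thesis by (simp add: prod_ennreal del: prod.cl_ivl_Suc)
    qed
    then have "(\<integral>\<^sup>+\<omega>. ennreal \<bar>(\<Prod>i\<in>{1..n}. c (Z i \<omega>)) * g (Z (Suc n) \<omega>)\<bar> \<partial>P)
        = (\<integral>\<^sup>+\<omega>. (\<Prod>i\<in>{1..Suc n}. ennreal \<bar>h i (Z i \<omega>)\<bar>) \<partial>P)"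
      by simp
    also have "\<dots> = (\<Prod>i\<in>{1..Suc n}. \<integral>\<^sup>+\<omega>. ennreal \<bar>h i (Z i \<omega>)\<bar> \<partial>P)"
      by (rule P.indep_vars_nn_integral[OF _ ind]) auto
    also have "\<dots> = (\<Prod>i\<in>{1..Suc n}. ennreal (expectation (\<lambda>k. \<bar>h i k\<bar>)))"
      by (intro prod.cong refl nn h_int) auto
    also have "\<dots> = ennreal (\<rho> ^ n * expectation (\<lambda>k. \<bar>g k\<bar>))"
      by (simp add: h_def atLeastAtMostSuc_conv prod_ennreal ennreal_mult'' mult.commute)
    finally show ?thesis .
  qed
  have "summable (\<lambda>n. \<rho> ^ n * expectation (\<lambda>k. \<bar>g k\<bar>))"
    using c_contr by (intro summable_mult2 summable_geometric) simp
  then have "(\<Sum>n. ennreal (\<rho> ^ n * expectation (\<lambda>k. \<bar>g k\<bar>))) \<noteq> \<infinity>"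
    by (subst suminf_ennreal2) auto
  then have "(\<integral>\<^sup>+\<omega>. (\<Sum>n. ennreal \<bar>(\<Prod>i\<in>{1..n}. c (Z i \<omega>)) * g (Z (Suc n) \<omega>)\<bar>) \<partial>P) \<noteq> \<infinity>"
    by (subst nn_integral_suminf) (simp_all add: nn_prod)
  then have "AE \<omega> in P. (\<Sum>n. ennreal \<bar>(\<Prod>i\<in>{1..n}. c (Z i \<omega>)) * g (Z (Suc n) \<omega>)\<bar>) \<noteq> \<infinity>"
    by (intro nn_integral_PInf_AE) simp_all
  then show ?thesis
    by eventually_elim (auto intro: summable_suminf_not_top)
qed

text \<open>The iteration started at 0 has summable increments, hence a limit \<open>W\<close>. Its
  law is \<open>\<nu>\<close> by bounded convergence of \<open>exp (i t Y_n(0))\<close> together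
  with \<open>expectation_backward\<close>. The vanishing slope extends the convergence to every
  bounded \<open>S\<close> with the same \<open>W\<close>.\<close>

lemma backward_limit:
  assumes d_int: "integrable K d" and \<nu>: "real_distribution \<nu>" "push \<nu> = \<nu>"
  obtains W where "W \<in> borel_measurable P" "distr P borel W = \<nu>"
    "\<And>S. bounded S \<Longrightarrow> AE \<omega> in P. uniform_limit S (Y \<omega>) (\<lambda>_. W \<omega>) sequentially"
proof -
  \<comment> \<open>On the null set without convergence \<open>lim\<close> is an unspecified value;
    \<open>W\<close> is still defined and measurable everywhere.\<close>
  define W where "W \<omega> = lim (\<lambda>n. Y \<omega> n 0)" for \<omega>
  have Y_meas [measurable]: "(\<lambda>\<omega>. Y \<omega> n x) \<in> borel_measurable P" for n x
    by (rule measurable_backward_iter) (auto intro: Z_meas)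
  have W_meas [measurable]: "W \<in> borel_measurable P"
    unfolding W_def by measurable
  have prod0: "AE \<omega> in P. (\<lambda>n. \<Prod>i\<in>{1..n}. c (Z i \<omega>)) \<longlonglongrightarrow> 0"
  proof -
    have "AE \<omega> in P. summable (\<lambda>n. \<bar>(\<Prod>i\<in>{1..n}. c (Z i \<omega>)) * 1\<bar>)"
      by (rule AE_summable_prod) auto
    then show ?thesis
      by eventually_elim (simp add: summable_LIMSEQ_zero tendsto_rabs_zero_cancel)
  qed
  have lim: "AE \<omega> in P. (\<lambda>n. Y \<omega> n 0) \<longlonglongrightarrow> W \<omega>"
    using AE_summable_prod[OF d_meas d_int]
  proof eventually_elim
    case (elim \<omega>)
    \<comment> \<open>The step with index \<open>Suc n\<close> sends 0 to
      \<open>d (Z (Suc n) \<omega>)\<close>, and \<open>backward_affine\<close> at this point gives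
      the increment.\<close>
    have "Y \<omega> (Suc n) 0 - Y \<omega> n 0 = (\<Prod>i\<in>{1..n}. c (Z i \<omega>)) * d (Z (Suc n) \<omega>)" for n
      using backward_affine[of \<omega> n "d (Z (Suc n) \<omega>)"] by (simp add: step_def[of _ "Suc n"])
    then have "summable (\<lambda>n. Y \<omega> (Suc n) 0 - Y \<omega> n 0)"
      using summable_rabs_cancel[OF elim] by simp
    then have "convergent (\<lambda>n. Y \<omega> n 0)"
      unfolding summable_iff_convergent sum_lessThan_telescope[of "\<lambda>n. Y \<omega> n 0"] by simp
    then show ?case
      by (simp add: W_def convergent_LIMSEQ_iff)
  qed
  have "distr P borel W = \<nu>"
  proof (rule Levy_uniqueness)
    show "char (distr P borel W) = char \<nu>"
    proof
      fix t
      have "(\<lambda>n. P.expectation (\<lambda>\<omega>. iexp (t * Y \<omega> n 0))) \<longlonglongrightarrow> P.expectation (\<lambda>\<omega>. iexp (t * W \<omega>))"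
      proof (rule integral_dominated_convergence[where w = "\<lambda>_. 1"])
        show "AE \<omega> in P. (\<lambda>n. iexp (t * Y \<omega> n 0)) \<longlonglongrightarrow> iexp (t * W \<omega>)"
          using lim by eventually_elim (intro tendsto_intros)
      qed (auto simp del: of_real_mult)
      moreover have "(\<lambda>n. P.expectation (\<lambda>\<omega>. iexp (t * Y \<omega> n 0))) \<longlonglongrightarrow> char \<nu> t"
        unfolding expectation_backward[OF test_fun_iexp] char_def
        by (rule avg_funpow_tendsto[OF \<nu> test_fun_iexp])
      ultimately show "char (distr P borel W) t = char \<nu> t"
        unfolding char_def by (subst integral_distr) (auto intro: LIMSEQ_unique simp del: of_real_mult)
    qed
  qed (use \<nu> in auto)
  moreover have "AE \<omega> in P. uniform_limit S (Y \<omega>) (\<lambda>_. W \<omega>) sequentially" if S: "bounded S" for S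
    using prod0 lim
  proof eventually_elim
    case (elim \<omega>)
    let ?\<Pi> = "\<lambda>n. \<Prod>i\<in>{1..n}. c (Z i \<omega>)"
    obtain r where r: "\<And>x. x \<in> S \<Longrightarrow> norm x \<le> r"
      using S by (auto simp: bounded_iff)
    show ?case
    proof (rule uniform_limitI)
      fix e :: real assume "e > 0"
      \<comment> \<open>A bound for the distance from \<open>Y \<omega> n x\<close> to
        \<open>W \<omega>\<close> that is free of \<open>x \<in> S\<close>: error at 0 plus slope
        times the radius of \<open>S\<close>.\<close>
      have "(\<lambda>n. \<bar>Y \<omega> n 0 - W \<omega>\<bar> + \<bar>?\<Pi> n\<bar> * r) \<longlonglongrightarrow> \<bar>W \<omega> - W \<omega>\<bar> + \<bar>0\<bar> * r"
        by (intro tendsto_intros elim)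
      then have "\<forall>\<^sub>F n in sequentially. \<bar>Y \<omega> n 0 - W \<omega>\<bar> + \<bar>?\<Pi> n\<bar> * r < e"
        by (rule order_tendstoD) (use \<open>e > 0\<close> in simp)
      then show "\<forall>\<^sub>F n in sequentially. \<forall>x\<in>S. dist (Y \<omega> n x) (W \<omega>) < e"
      proof eventually_elim
        case (elim n)
        show ?case
        proof
          fix x assume "x \<in> S"
          then have "\<bar>?\<Pi> n * x\<bar> \<le> \<bar>?\<Pi> n\<bar> * r"
            using r by (auto simp: abs_mult intro: mult_left_mono)
          then show "dist (Y \<omega> n x) (W \<omega>) < e"
            using elim backward_affine[of \<omega> n x] by (simp add: dist_real_def)
        qed
      qed
    qed
  qed
  ultimately show thesis
    by (rule that[OF W_meas])
qed

end

section \<open>Beta and gamma laws\<close>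

lemma beta_density_measurable [measurable]: "beta_density a b \<in> borel_measurable borel"
  unfolding beta_density_def by measurable

lemma gamma_density_measurable [measurable]: "gamma_density a \<in> borel_measurable borel"
  unfolding gamma_density_def by measurable

lemma sets_beta_law [measurable_cong, simp]: "sets (beta_law a b) = sets borel"
  by (simp add: beta_law_def)

lemma sets_gamma_law [measurable_cong, simp]: "sets (gamma_law a) = sets borel"
  by (simp add: gamma_law_def)

lemma space_beta_law [simp]: "space (beta_law a b) = UNIV"
  by (simp add: beta_law_def)

lemma space_gamma_law [simp]: "space (gamma_law a) = UNIV"
  by (simp add: gamma_law_def)

lemma Beta_pos: "a > 0 \<Longrightarrow> b > 0 \<Longrightarrow> Beta a b > (0::real)"
  by (simp add: Beta_def)

lemma Beta_1_right: "a > 0 \<Longrightarrow> Beta a 1 = 1 / (a::real)"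
  by (simp add: Beta_def Gamma_plus1 nonpos_Ints_def Gamma_eq_zero_iff)

lemma beta_density_nonneg: "a > 0 \<Longrightarrow> b > 0 \<Longrightarrow> beta_density a b u \<ge> 0"
  using Beta_pos[of a b] by (simp add: beta_density_def)

lemma gamma_density_nonneg: "a > 0 \<Longrightarrow> gamma_density a v \<ge> 0"
  by (simp add: gamma_density_def)

lemma nn_integral_beta_law:
  "f \<in> borel_measurable borel \<Longrightarrow>
    (\<integral>\<^sup>+u. f u \<partial>beta_law a b) = (\<integral>\<^sup>+u. ennreal (beta_density a b u) * f u \<partial>lborel)"
  unfolding beta_law_def by (rule nn_integral_density) auto

lemma nn_integral_gamma_law:
  "f \<in> borel_measurable borel \<Longrightarrow>
    (\<integral>\<^sup>+v. f v \<partial>gamma_law a) = (\<integral>\<^sup>+v. ennreal (gamma_density a v) * f v \<partial>lborel)"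
  unfolding gamma_law_def by (rule nn_integral_density) auto

lemma prob_space_beta_law:
  assumes "a > 0" "b > 0"
  shows "prob_space (beta_law a b)"
proof
  have "emeasure (beta_law a b) (space (beta_law a b)) = (\<integral>\<^sup>+u. ennreal (beta_density a b u) \<partial>lborel)"
    using nn_integral_beta_law[of "\<lambda>_. 1" a b] by simp
  \<comment> \<open>The closed interval is harmless even pointwise: \<open>0 powr r = 0\<close> for
    every \<open>r\<close>, so the formula vanishes at both endpoints.\<close>
  also have "\<dots> = (\<integral>\<^sup>+u. ennreal (u powr (a - 1) * (1 - u) powr (b - 1) / Beta a b) * indicator {0..1} u \<partial>lborel)"
    by (intro nn_integral_cong) (auto simp: beta_density_def indicator_def)
  also have "\<dots> = ennreal (Beta a b / Beta a b)"
    using Beta_pos[OF assms]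
    by (intro nn_integral_has_integral_lebesgue' has_integral_divide has_integral_Beta_real assms) auto
  also have "\<dots> = 1"
    using Beta_pos[OF assms] by simp
  finally show "emeasure (beta_law a b) (space (beta_law a b)) = 1" .
qed

lemma prob_space_gamma_law:
  assumes "a > 0"
  shows "prob_space (gamma_law a)"
proof
  have "emeasure (gamma_law a) (space (gamma_law a)) = (\<integral>\<^sup>+v. ennreal (gamma_density a v) \<partial>lborel)"
    using nn_integral_gamma_law[of "\<lambda>_. 1" a] by simp
  also have "\<dots> = (\<integral>\<^sup>+v. ennreal (v powr (a - 1) / exp v / Gamma a) * indicator {0..} v \<partial>lborel)"
    by (intro nn_integral_cong) (auto simp: gamma_density_def indicator_def exp_minus field_simps)
  also have "\<dots> = ennreal (Gamma a / Gamma a)"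
    using Gamma_real_pos[OF assms]
    by (intro nn_integral_has_integral_lebesgue' has_integral_divide Gamma_integral_real assms) auto
  also have "\<dots> = 1"
    using Gamma_real_pos[OF assms] by simp
  finally show "emeasure (gamma_law a) (space (gamma_law a)) = 1" .
qed

lemma real_distribution_beta_law: "a > 0 \<Longrightarrow> b > 0 \<Longrightarrow> real_distribution (beta_law a b)"
  by (simp add: real_distribution_def real_distribution_axioms_def prob_space_beta_law)

lemma real_distribution_gamma_law: "a > 0 \<Longrightarrow> real_distribution (gamma_law a)"
  by (simp add: real_distribution_def real_distribution_axioms_def prob_space_gamma_law)

lemma AE_beta_law: "AE u in beta_law a b. 0 < u \<and> u < 1"
  unfolding beta_law_def by (subst AE_density) (auto simp: beta_density_def)

text \<open>The substitution \<open>u \<mapsto> 1 - u\<close> swaps the parameters. It converts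
  \<open>L\<close> with law \<open>\<beta>(1, y + z)\<close> into \<open>1 - L\<close> with law
  \<open>\<beta>(y + z, 1)\<close>.\<close>

lemma nn_integral_beta_law_reflect:
  assumes [measurable]: "f \<in> borel_measurable borel"
  shows "(\<integral>\<^sup>+u. f (1 - u) \<partial>beta_law a b) = (\<integral>\<^sup>+u. f u \<partial>beta_law b a)"
proof -
  have refl: "beta_density b a (1 - u) = beta_density a b u" for u
    by (auto simp: beta_density_def Beta_commute)
  have "(\<integral>\<^sup>+u. f u \<partial>beta_law b a) = (\<integral>\<^sup>+u. ennreal (beta_density b a u) * f u \<partial>lborel)"
    by (simp add: nn_integral_beta_law)
  also have "\<dots> = (\<integral>\<^sup>+u. ennreal (beta_density b a (1 - u)) * f (1 - u) \<partial>lborel)"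
    by (subst nn_integral_real_affine[where c = "-1" and t = 1]) auto
  also have "\<dots> = (\<integral>\<^sup>+u. f (1 - u) \<partial>beta_law a b)"
    by (simp add: refl nn_integral_beta_law)
  finally show ?thesis ..
qed

text \<open>No antiderivative is computed: the density is homogeneous on \<open>(0, 1)\<close>, so
  the substitution \<open>u \<mapsto> t u\<close> turns the mass below \<open>t\<close> into
  \<open>t powr a\<close> times the total mass. The \<open>min\<close> admits thresholds above 1,
  such as \<open>t / u\<close> with small \<open>u\<close>.\<close>

lemma emeasure_beta_law_1:
  assumes "a > 0" "0 \<le> t"
  shows "emeasure (beta_law a 1) {..t} = ennreal (min 1 t powr a)"
proof -
  interpret prob_space "beta_law a 1"
    using assms by (simp add: prob_space_beta_law)
  have le1: "emeasure (beta_law a 1) {..t} = ennreal (t powr a)" if "0 < t" "t \<le> 1" for t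
  proof -
    have "emeasure (beta_law a 1) {..t}
        = (\<integral>\<^sup>+u. ennreal (beta_density a 1 u) * indicator {..t} u \<partial>lborel)"
      by (simp add: nn_integral_beta_law flip: nn_integral_indicator)
    also have "\<dots> = ennreal \<bar>t\<bar> * (\<integral>\<^sup>+u. ennreal (beta_density a 1 (0 + t * u)) * indicator {..t} (0 + t * u) \<partial>lborel)"
      by (rule nn_integral_real_affine) (use that in auto)
    also have "\<dots> = (\<integral>\<^sup>+u. ennreal t * (ennreal (beta_density a 1 (t * u)) * indicator {..t} (t * u)) \<partial>lborel)"
      using that by (subst nn_integral_cmult[symmetric]) auto
    also have "\<dots> = (\<integral>\<^sup>+u. ennreal (t powr a) * ennreal (beta_density a 1 u) \<partial>lborel)"
    \<comment> \<open>The point \<open>u = 1\<close> is excluded: for \<open>t < 1\<close> the left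
      side is positive there, while the density at 1 is 0.\<close>
    proof (rule nn_integral_cong_AE, rule AE_mp[OF AE_lborel_singleton[of 1]], rule AE_I2, rule impI)
      fix u :: real assume "u \<noteq> 1"
      consider "u \<le> 0" | "u > 1" | "0 < u" "u < 1"
        using \<open>u \<noteq> 1\<close> by linarith
      then show "ennreal t * (ennreal (beta_density a 1 (t * u)) * indicator {..t} (t * u))
          = ennreal (t powr a) * ennreal (beta_density a 1 u)"
      proof cases
        case 1
        then have "t * u \<le> 0" using that by (simp add: mult_nonneg_nonpos)
        then show ?thesis using 1 by (simp add: beta_density_def)
      next
        case 2
        then have "\<not> t * u \<le> t" using that by simp
        then show ?thesis using 2 by (simp add: beta_density_def)
      next
        case 3
        then have *: "0 < t * u" "t * u \<le> t" "t * u < 1"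
          using that by (auto simp: mult_le_one mult_less_cancel_left1 intro: le_less_trans[of "t * u" u] mult_left_le_one_le)
        have "t * (t * u) powr (a - 1) = t powr a * u powr (a - 1)"
          using that 3 by (simp add: powr_mult powr_diff)
        then show ?thesis
          using that 3 * assms by (simp add: beta_density_def Beta_1_right mult_ac flip: ennreal_mult')
      qed
    qed
    also have "\<dots> = ennreal (t powr a) * emeasure (beta_law a 1) (space (beta_law a 1))"
      using nn_integral_beta_law[of "\<lambda>_. 1" a 1] by (subst nn_integral_cmult) auto
    finally show ?thesis
      unfolding emeasure_space_1 by simp
  qed
  consider "t = 0" | "0 < t" "t \<le> 1" | "1 < t"
    using assms by linarith
  then show ?thesis
  proof cases
    case 1
    have "emeasure (beta_law a 1) {..t} = (\<integral>\<^sup>+u. ennreal (beta_density a 1 u) * indicator {..t} u \<partial>lborel)"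
      by (simp add: nn_integral_beta_law flip: nn_integral_indicator)
    also have "\<dots> = (\<integral>\<^sup>+(u::real). 0 \<partial>lborel)"
      by (intro nn_integral_cong) (use 1 in \<open>auto simp: beta_density_def indicator_def\<close>)
    finally show ?thesis using 1 by simp
  next
    case 2
    then show ?thesis by (simp add: le1)
  next
    case 3
    have "emeasure (beta_law a 1) {..1} \<le> emeasure (beta_law a 1) {..t}"
      using 3 by (intro emeasure_mono) auto
    then show ?thesis
      using 3 le1[of 1] by (simp add: antisym[OF emeasure_le_1])
  qed
qed

text \<open>Values on \<open>(0, 1)\<close> suffice: \<open>t powr a\<close> tends to 0 and 1 at the
  two ends, so monotonicity forces the distribution function to be 0 up to 0 and 1 from 1
  on.\<close>

lemma beta_law_1_eqI:
  assumes a: "a > 0" and M: "real_distribution M"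
    and cdf: "\<And>t. 0 < t \<Longrightarrow> t < 1 \<Longrightarrow> emeasure M {..t} = ennreal (t powr a)"
  shows "M = beta_law a 1"
proof -
  have cdf_eq: "cdf Q t = (if t \<le> 0 then 0 else if t < 1 then t powr a else 1)"
    if Q: "real_distribution Q" and mid: "\<And>t. 0 < t \<Longrightarrow> t < 1 \<Longrightarrow> emeasure Q {..t} = ennreal (t powr a)"
    for Q t
  proof -
    interpret Q: real_distribution Q by fact
    have mid': "cdf Q s = s powr a" if "0 < s" "s < 1" for s
      using mid[OF that] by (simp add: cdf_def measure_def)
    \<comment> \<open>The point at which the distribution function takes the prescribed level
      \<open>e\<close>; letting \<open>e\<close> approach 0 or 1 settles the outer ranges.\<close>
    have root: "cdf Q (e powr (1 / a)) = e" "e powr (1 / a) < 1" if "0 < e" "e < 1" for e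
    proof -
      show lt: "e powr (1 / a) < 1"
        using that a powr_less_mono2[of "1 / a" e 1] by simp
      show "cdf Q (e powr (1 / a)) = e"
        using that a lt by (subst mid') (auto simp: powr_powr)
    qed
    consider "t \<le> 0" | "0 < t" "t < 1" | "1 \<le> t" by linarith
    then show ?thesis
    proof cases
      case 1
      have "cdf Q t \<le> 0 + e" if "0 < e" for e
      proof -
        have "cdf Q t \<le> cdf Q ((min e (1/2)) powr (1 / a))"
          using 1 that by (intro Q.cdf_nondecreasing) (auto intro: order_trans[OF 1])
        then show ?thesis using that root[of "min e (1/2)"] by simp
      qed
      then have "cdf Q t \<le> 0" by (rule field_le_epsilon)
      then show ?thesis using 1 Q.cdf_nonneg[of t] by simp
    next
      case 2
      then show ?thesis by (simp add: mid')
    next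
      case 3
      have "e \<le> cdf Q t" if "0 < e" "e < 1" for e
        using Q.cdf_nondecreasing[of "e powr (1 / a)" t] root[OF that] 3 by simp
      then have "1 \<le> cdf Q t"
        by (rule dense_le_bounded[of 0, rotated]) auto
      then show ?thesis using 3 Q.cdf_bounded_prob[of t] by simp
    qed
  qed
  show ?thesis
  proof (rule cdf_unique)
    show "cdf M = cdf (beta_law a 1)"
      using cdf_eq[OF M cdf] cdf_eq[OF real_distribution_beta_law[OF a, of 1]] a
      by (auto simp: fun_eq_iff emeasure_beta_law_1)
  qed (use a M in \<open>auto intro: real_distribution_beta_law\<close>)
qed

text \<open>The change of variables \<open>(s, x) \<mapsto> (x s, (1 - x) s)\<close> is done in two
  one-dimensional steps: \<open>v = x s\<close> at fixed \<open>s\<close>, then, after Fubini,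
  \<open>w = s - v\<close>. Being stated for every nonnegative measurable \<open>f\<close>, the
  identity gives the joint law.\<close>

lemma beta_gamma_algebra:
  fixes f :: "real \<Rightarrow> real \<Rightarrow> ennreal"
  assumes ab: "a > 0" "b > 0"
    and [measurable]: "case_prod f \<in> borel_measurable (borel \<Otimes>\<^sub>M borel)"
  shows "(\<integral>\<^sup>+s. \<integral>\<^sup>+x. f (x * s) ((1 - x) * s) \<partial>beta_law a b \<partial>gamma_law (a + b))
       = (\<integral>\<^sup>+v. \<integral>\<^sup>+w. f v w \<partial>gamma_law b \<partial>gamma_law a)"
proof -
  interpret lborel_pair: pair_sigma_finite lborel lborel ..
  have f_meas [measurable]:
    "(\<lambda>w. f (g w) (h w)) \<in> borel_measurable N"
    if [measurable]: "g \<in> borel_measurable N" "h \<in> borel_measurable N" for g h and N :: "'z measure"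
    using measurable_compose[of "\<lambda>w. (g w, h w)" N "borel \<Otimes>\<^sub>M borel" "case_prod f" borel] by simp
  \<comment> \<open>The factor \<open>1 / s\<close> is the Jacobian of \<open>v = x s\<close>. All
    powers of \<open>s\<close> cancel, and the constants match by
    \<open>Gamma (a + b) * Beta a b = Gamma a * Gamma b\<close>.\<close>
  have dens: "gamma_density (a + b) s * (1 / s) * beta_density a b (v / s)
      = gamma_density a v * gamma_density b (s - v)" if "s > 0" for s v
  proof (cases "0 < v \<and> v < s")
    case True
    have "1 - v / s = (s - v) / s"
      using that by (simp add: field_simps)
    then have powr: "s powr (a + b - 1) * (1 / s) * ((v / s) powr (a - 1) * (1 - v / s) powr (b - 1))
        = v powr (a - 1) * (s - v) powr (b - 1)"
      using True that by (simp add: powr_divide powr_diff powr_add)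
    have exp: "exp (- s) = exp (- v) * exp (- (s - v))"
      by (simp flip: exp_add)
    have Beta: "Gamma (a + b) * Beta a b = Gamma a * Gamma b"
      using ab Gamma_real_pos[of "a + b"]
      by (simp add: Beta_def less_imp_neq[symmetric] del: Gamma_real_pos)
    have "gamma_density (a + b) s * (1 / s) * beta_density a b (v / s)
        = s powr (a + b - 1) * (1 / s) * ((v / s) powr (a - 1) * (1 - v / s) powr (b - 1))
          * exp (- s) / (Gamma (a + b) * Beta a b)"
      using True that by (simp add: gamma_density_def beta_density_def mult_ac)
    also have "\<dots> = gamma_density a v * gamma_density b (s - v)"
    proof -
      have "gamma_density a v = v powr (a - 1) * exp (- v) / Gamma a"
        "gamma_density b (s - v) = (s - v) powr (b - 1) * exp (- (s - v)) / Gamma b"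
        using True by (simp_all add: gamma_density_def)
      then show ?thesis
        unfolding powr exp Beta by (simp only: times_divide_times_eq mult_ac)
    qed
    finally show ?thesis .
  next
    case False
    then have "\<not> (0 < v / s \<and> v / s < 1)"
      using that by (simp add: zero_less_divide_iff)
    then have "beta_density a b (v / s) = 0"
      unfolding beta_density_def by (rule if_not_P)
    moreover have "gamma_density a v * gamma_density b (s - v) = 0"
      using False by (cases "0 < v") (simp_all add: gamma_density_def)
    ultimately show ?thesis by simp
  qed
  have "(\<integral>\<^sup>+s. \<integral>\<^sup>+x. f (x * s) ((1 - x) * s) \<partial>beta_law a b \<partial>gamma_law (a + b))
      = (\<integral>\<^sup>+s. ennreal (gamma_density (a + b) s)
          * (\<integral>\<^sup>+x. ennreal (beta_density a b x) * f (x * s) ((1 - x) * s) \<partial>lborel) \<partial>lborel)"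
    by (subst nn_integral_gamma_law) (auto simp: nn_integral_beta_law)
  also have "\<dots> = (\<integral>\<^sup>+s. \<integral>\<^sup>+v. ennreal (gamma_density a v) * (ennreal (gamma_density b (s - v)) * f v (s - v)) \<partial>lborel \<partial>lborel)"
  proof (rule nn_integral_cong)
    fix s :: real
    show "ennreal (gamma_density (a + b) s)
          * (\<integral>\<^sup>+x. ennreal (beta_density a b x) * f (x * s) ((1 - x) * s) \<partial>lborel)
        = (\<integral>\<^sup>+v. ennreal (gamma_density a v) * (ennreal (gamma_density b (s - v)) * f v (s - v)) \<partial>lborel)"
    proof (cases "s > 0")
      case True
      have "(\<integral>\<^sup>+x. ennreal (beta_density a b x) * f (x * s) ((1 - x) * s) \<partial>lborel)
          = ennreal \<bar>1 / s\<bar> * (\<integral>\<^sup>+v. ennreal (beta_density a b (0 + 1 / s * v))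
              * f ((0 + 1 / s * v) * s) ((1 - (0 + 1 / s * v)) * s) \<partial>lborel)"
        by (rule nn_integral_real_affine) (use True in auto)
      also have "\<dots> = ennreal (1 / s) * (\<integral>\<^sup>+v. ennreal (beta_density a b (v / s)) * f v (s - v) \<partial>lborel)"
        using True by (simp add: left_diff_distrib)
      finally have eq: "(\<integral>\<^sup>+x. ennreal (beta_density a b x) * f (x * s) ((1 - x) * s) \<partial>lborel)
          = ennreal (1 / s) * (\<integral>\<^sup>+v. ennreal (beta_density a b (v / s)) * f v (s - v) \<partial>lborel)" .
      have "ennreal (gamma_density (a + b) s)
            * (\<integral>\<^sup>+x. ennreal (beta_density a b x) * f (x * s) ((1 - x) * s) \<partial>lborel)
          = (\<integral>\<^sup>+v. ennreal (gamma_density (a + b) s) * ennreal (1 / s)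
              * (ennreal (beta_density a b (v / s)) * f v (s - v)) \<partial>lborel)"
        unfolding eq by (subst nn_integral_cmult) (auto simp: mult.assoc)
      also have "\<dots> = (\<integral>\<^sup>+v. ennreal (gamma_density a v) * (ennreal (gamma_density b (s - v)) * f v (s - v)) \<partial>lborel)"
      proof (rule nn_integral_cong)
        fix v :: real
        have "ennreal (gamma_density (a + b) s) * ennreal (1 / s) * ennreal (beta_density a b (v / s))
            = ennreal (gamma_density a v) * ennreal (gamma_density b (s - v))"
          using dens[OF True, of v] True ab
          by (simp add: gamma_density_nonneg beta_density_nonneg flip: ennreal_mult)
        then show "ennreal (gamma_density (a + b) s) * ennreal (1 / s)
              * (ennreal (beta_density a b (v / s)) * f v (s - v))
            = ennreal (gamma_density a v) * (ennreal (gamma_density b (s - v)) * f v (s - v))"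
          by (simp flip: mult.assoc)
      qed
      finally show ?thesis .
    next
      case False
      \<comment> \<open>For \<open>s \<le> 0\<close> the numbers \<open>v\<close> and
        \<open>s - v\<close> cannot both be positive.\<close>
      then have "gamma_density a v = 0 \<or> gamma_density b (s - v) = 0" for v
        by (auto simp: gamma_density_def)
      then have zero: "ennreal (gamma_density a v) * (ennreal (gamma_density b (s - v)) * f v (s - v)) = 0" for v
        by (metis ennreal_0 mult_zero_left mult_zero_right)
      have "gamma_density (a + b) s = 0"
        using False by (simp add: gamma_density_def)
      then show ?thesis
        unfolding zero by simp
    qed
  qed
  also have "\<dots> = (\<integral>\<^sup>+v. \<integral>\<^sup>+s. ennreal (gamma_density a v) * (ennreal (gamma_density b (s - v)) * f v (s - v)) \<partial>lborel \<partial>lborel)"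
    by (rule lborel_pair.Fubini') (simp add: split_beta')
  also have "\<dots> = (\<integral>\<^sup>+v. ennreal (gamma_density a v) * (\<integral>\<^sup>+w. ennreal (gamma_density b w) * f v w \<partial>lborel) \<partial>lborel)"
  proof (rule nn_integral_cong)
    fix v :: real
    have "(\<integral>\<^sup>+s. ennreal (gamma_density b (s - v)) * f v (s - v) \<partial>lborel)
        = (\<integral>\<^sup>+w. ennreal (gamma_density b w) * f v w \<partial>lborel)"
      by (subst nn_integral_real_affine[where c = 1 and t = v]) auto
    then show "(\<integral>\<^sup>+s. ennreal (gamma_density a v) * (ennreal (gamma_density b (s - v)) * f v (s - v)) \<partial>lborel)
        = ennreal (gamma_density a v) * (\<integral>\<^sup>+w. ennreal (gamma_density b w) * f v w \<partial>lborel)"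
      by (simp add: nn_integral_cmult)
  qed
  also have "\<dots> = (\<integral>\<^sup>+v. \<integral>\<^sup>+w. f v w \<partial>gamma_law b \<partial>gamma_law a)"
    by (subst nn_integral_gamma_law) (auto simp: nn_integral_gamma_law)
  finally show ?thesis .
qed

section \<open>The beta mixture\<close>

lemma borel_measurable_fst_snd [measurable]:
  "(fst :: 'a::second_countable_topology \<times> 'b::second_countable_topology \<Rightarrow> 'a) \<in> borel_measurable borel"
  "(snd :: 'a \<times> 'b \<Rightarrow> 'b) \<in> borel_measurable borel"
  by (auto intro!: borel_measurable_continuous_onI continuous_intros)

text \<open>Rewrites an equation over the law of \<open>g\<close> as one over the underlying noise
  \<open>K\<close>.\<close>

lemma distr_pair_distr:
  assumes "prob_space \<nu>" and K: "prob_space K"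
    and g [measurable]: "g \<in> measurable K T" and h [measurable]: "h \<in> measurable (\<nu> \<Otimes>\<^sub>M T) S"
  shows "distr (\<nu> \<Otimes>\<^sub>M distr K T g) S h = distr (\<nu> \<Otimes>\<^sub>M K) S (\<lambda>(x, k). h (x, g k))"
proof -
  interpret K: prob_space K by fact
  have "\<nu> \<Otimes>\<^sub>M distr K T g = distr \<nu> \<nu> (\<lambda>x. x) \<Otimes>\<^sub>M distr K T g"
    by simp
  also have "\<dots> = distr (\<nu> \<Otimes>\<^sub>M K) (\<nu> \<Otimes>\<^sub>M T) (\<lambda>(x, k). (x, g k))"
    by (rule pair_measure_distr)
      (auto intro!: prob_space_imp_sigma_finite K.prob_space_distr)
  finally show ?thesis
    by (simp add: distr_distr comp_def split_beta')
qed

text \<open>Given \<open>I\<close>, only one of \<open>L\<close> and \<open>R\<close> is visible, so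
  only their marginal laws enter and the dependence between them is irrelevant.\<close>

lemma nn_integral_bernoulli_mixture:
  fixes I :: "'n \<Rightarrow> bool" and L R :: "'n \<Rightarrow> real"
  assumes "prob_space N" and p: "0 \<le> p" "p \<le> 1"
    and I: "distr N (count_space UNIV) I = measure_pmf (bernoulli_pmf p)"
    and indep: "indep_rv N (count_space UNIV) I borel (\<lambda>\<omega>. (L \<omega>, R \<omega>))"
    and [measurable]: "f \<in> borel_measurable borel"
  shows "(\<integral>\<^sup>+\<omega>. f (of_bool (I \<omega>) *\<^sub>R (1 - L \<omega>, 0) + (1 - of_bool (I \<omega>)) *\<^sub>R (1, R \<omega>)) \<partial>N)
    = ennreal p * (\<integral>\<^sup>+l. f (1 - l, 0) \<partial>distr N borel L)
      + ennreal (1 - p) * (\<integral>\<^sup>+r. f (1, r) \<partial>distr N borel R)"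
proof -
  interpret prob_space N by fact
  have [measurable]: "I \<in> measurable N (count_space UNIV)"
    and LR [measurable]: "(\<lambda>\<omega>. (L \<omega>, R \<omega>)) \<in> borel_measurable N"
    using indep by (auto simp: indep_rv_def)
  have [measurable]: "L \<in> borel_measurable N" "R \<in> borel_measurable N"
    using measurable_compose[OF LR, of fst borel] measurable_compose[OF LR, of snd borel]
    by (simp_all add: borel_measurable_continuous_onI continuous_on_fst continuous_on_snd)
  define LRlaw where "LRlaw = distr N borel (\<lambda>\<omega>. (L \<omega>, R \<omega>))"
  interpret LR: prob_space LRlaw
    unfolding LRlaw_def by (rule prob_space_distr) simp
  have [measurable_cong]: "sets LRlaw = sets borel"
    by (simp add: LRlaw_def)
  let ?h = "\<lambda>i w. f (of_bool i *\<^sub>R (1 - fst w, 0) + (1 - of_bool i) *\<^sub>R (1, snd w))"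
  have [measurable]: "(\<lambda>x. of_bool (fst x) :: real) \<in> borel_measurable (count_space UNIV \<Otimes>\<^sub>M borel)"
    by (rule measurable_compose[OF measurable_fst]) simp
  have meas: "case_prod ?h \<in> borel_measurable (count_space UNIV \<Otimes>\<^sub>M borel)"
    unfolding split_beta' by measurable
  have "(\<integral>\<^sup>+\<omega>. f (of_bool (I \<omega>) *\<^sub>R (1 - L \<omega>, 0) + (1 - of_bool (I \<omega>)) *\<^sub>R (1, R \<omega>)) \<partial>N)
      = (\<integral>\<^sup>+w. case_prod ?h w \<partial>distr N (count_space UNIV \<Otimes>\<^sub>M borel) (\<lambda>\<omega>. (I \<omega>, L \<omega>, R \<omega>)))"
    using meas by (subst nn_integral_distr) auto
  also have "\<dots> = (\<integral>\<^sup>+w. case_prod ?h w \<partial>(measure_pmf (bernoulli_pmf p) \<Otimes>\<^sub>M LRlaw))"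
    using indep unfolding indep_rv_def I LRlaw_def by simp
  also have "\<dots> = (\<integral>\<^sup>+i. \<integral>\<^sup>+w. ?h i w \<partial>LRlaw \<partial>measure_pmf (bernoulli_pmf p))"
    by (subst LR.nn_integral_fst[symmetric]) (use meas in \<open>simp_all cong: measurable_cong_sets\<close>)
  also have "\<dots> = ennreal p * (\<integral>\<^sup>+w. ?h True w \<partial>LRlaw) + ennreal (1 - p) * (\<integral>\<^sup>+w. ?h False w \<partial>LRlaw)"
    using p by (subst nn_integral_bernoulli_pmf) (auto simp: mult.commute)
  also have "(\<integral>\<^sup>+w. ?h True w \<partial>LRlaw) = (\<integral>\<^sup>+l. f (1 - l, 0) \<partial>distr N borel L)"
    unfolding LRlaw_def by (subst (1 2) nn_integral_distr) auto
  also have "(\<integral>\<^sup>+w. ?h False w \<partial>LRlaw) = (\<integral>\<^sup>+r. f (1, r) \<partial>distr N borel R)"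
    unfolding LRlaw_def by (subst (1 2) nn_integral_distr) auto
  finally show ?thesis .
qed

section \<open>The law of \<open>(A, B)\<close> and its invariant beta and gamma laws\<close>

locale beta_mixture = mu: prob_space mu
  for y z p :: real and mu :: "(real \<times> real) measure" +
  assumes y: "y > 0" and z: "z > 0" and p: "p = y / (y + z)"
    and sets_mu [measurable_cong]: "sets mu = sets borel"
    and nn_integral_mu: "\<And>f. f \<in> borel_measurable borel \<Longrightarrow>
      (\<integral>\<^sup>+ab. f ab \<partial>mu) = ennreal p * (\<integral>\<^sup>+u. f (u, 0) \<partial>beta_law (y + z) 1)
        + ennreal (1 - p) * (\<integral>\<^sup>+r. f (1, r) \<partial>beta_law y (z + 1))"
begin

lemma p_bounds: "0 < p" "p < 1"
  using y z by (simp_all add: p)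

text \<open>Source of the mean contraction: the law \<open>\<beta>(y + z, 1)\<close> has mean
  \<open>q = (y + z) / (y + z + 1) < 1\<close> and is chosen with probability \<open>p > 0\<close>,
  so the bound is \<open>p q + (1 - p) = 1 - p / (y + z + 1)\<close>.\<close>

lemma nn_integral_mu_le:
  assumes [measurable]: "f \<in> borel_measurable borel"
    and u: "\<And>u. 0 < u \<Longrightarrow> u < 1 \<Longrightarrow> f (u, 0) \<le> ennreal u"
    and r: "\<And>r. 0 < r \<Longrightarrow> r < 1 \<Longrightarrow> f (1, r) \<le> 1"
  shows "(\<integral>\<^sup>+ab. f ab \<partial>mu) \<le> ennreal (1 - p / (y + z + 1))"
proof -
  interpret R: prob_space "beta_law y (z + 1)"
    using y z by (intro prob_space_beta_law) auto
  interpret U: prob_space "beta_law (y + z + 1) 1"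
    using y z by (intro prob_space_beta_law) auto
  let ?q = "(y + z) / (y + z + 1)"
  have mean: "(\<integral>\<^sup>+u. ennreal u \<partial>beta_law (y + z) 1) = ennreal ?q"
  proof -
    \<comment> \<open>Size biasing: weighting \<open>\<beta>(c, 1)\<close> by \<open>u\<close> gives
      \<open>c / (c + 1)\<close> times \<open>\<beta>(c + 1, 1)\<close>.\<close>
    have *: "beta_density (y + z) 1 u * u = ?q * beta_density (y + z + 1) 1 u" if "0 \<le> u" for u
    proof (cases "0 < u \<and> u < 1")
      case True
      then show ?thesis
        using y z powr_mult_base[of u "y + z - 1"]
        by (simp add: beta_density_def Beta_1_right mult_ac)
    next
      case False
      then have "beta_density c 1 u = 0" for c
        unfolding beta_density_def by (rule if_not_P)
      then show ?thesis by simp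
    qed
    have "ennreal (beta_density (y + z) 1 u) * ennreal u
        = ennreal ?q * ennreal (beta_density (y + z + 1) 1 u)" for u
    proof (cases "0 \<le> u")
      case True
      with * show ?thesis
        using y z by (simp add: beta_density_nonneg flip: ennreal_mult)
    next
      case False
      then have "beta_density c 1 u = 0" for c
        by (simp add: beta_density_def)
      then show ?thesis by simp
    qed
    then have "(\<integral>\<^sup>+u. ennreal u \<partial>beta_law (y + z) 1)
        = (\<integral>\<^sup>+u. ennreal ?q * ennreal (beta_density (y + z + 1) 1 u) \<partial>lborel)"
      by (simp add: nn_integral_beta_law)
    also have "\<dots> = ennreal ?q * emeasure (beta_law (y + z + 1) 1) (space (beta_law (y + z + 1) 1))"
      using nn_integral_beta_law[of "\<lambda>_. 1" "y + z + 1" 1] by (subst nn_integral_cmult) auto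
    finally show ?thesis
      unfolding U.emeasure_space_1 by simp
  qed
  have "(\<integral>\<^sup>+u. f (u, 0) \<partial>beta_law (y + z) 1) \<le> (\<integral>\<^sup>+u. ennreal u \<partial>beta_law (y + z) 1)"
    by (rule nn_integral_mono_AE) (use AE_beta_law in eventually_elim, auto intro: u)
  moreover have "(\<integral>\<^sup>+r. f (1, r) \<partial>beta_law y (z + 1)) \<le> (\<integral>\<^sup>+r. 1 \<partial>beta_law y (z + 1))"
    by (rule nn_integral_mono_AE) (use AE_beta_law in eventually_elim, auto intro: r)
  ultimately have "(\<integral>\<^sup>+ab. f ab \<partial>mu) \<le> ennreal p * ennreal ?q + ennreal (1 - p) * 1"
    unfolding nn_integral_mu[OF assms(1)] mean
    by (intro add_mono mult_left_mono) (simp_all add: R.emeasure_space_1[simplified])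
  also have "\<dots> = ennreal (p * ?q + (1 - p))"
    using y z p_bounds by (simp flip: ennreal_mult ennreal_plus)
  also have "p * ?q + (1 - p) = 1 - p / (y + z + 1)"
    using y z by (simp add: field_simps)
  finally show ?thesis .
qed

text \<open>Conditioning on \<open>(A, B)\<close> gives the distribution function on
  \<open>(0, 1)\<close>. The branch \<open>(u, 0)\<close> contributes
  \<open>t^(y+z) + t^z ((y+z)/y) (1 - t^y)\<close>, the branch \<open>(1, r)\<close> contributes
  \<open>t^(y+z)\<close>. With weights \<open>p\<close> and \<open>1 - p\<close>, where
  \<open>p (y+z)/y = 1\<close>, the sum is \<open>t^z\<close>.\<close>

lemma mix_beta: "mix_equation_solution mu (beta_law z 1)"
proof -
  interpret X: prob_space "beta_law z 1"
    using z by (intro prob_space_beta_law) auto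
  interpret XM: pair_prob_space "beta_law z 1" mu ..
  let ?h = "\<lambda>(x, A, B). A * x + B * (1 - x) :: real"
  have h_meas [measurable]: "?h \<in> borel_measurable (beta_law z 1 \<Otimes>\<^sub>M mu)"
    unfolding split_beta' by measurable
  \<comment> \<open>The conditional distribution function of \<open>A X + B (1 - X)\<close> at
    \<open>t\<close>, given \<open>(A, B) = ab\<close>.\<close>
  define G where "G t ab = emeasure (beta_law z 1) {x. fst ab * x + snd ab * (1 - x) \<le> t}"
    for t and ab :: "real \<times> real"
  have G_ind: "G t ab = (\<integral>\<^sup>+x. indicator {..t} (fst ab * x + snd ab * (1 - x)) \<partial>beta_law z 1)" for t ab
  proof -
    have "{x. fst ab * x + snd ab * (1 - x) \<le> t} \<in> sets (beta_law z 1)"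
      by simp
    then have "G t ab = (\<integral>\<^sup>+x. indicator {x. fst ab * x + snd ab * (1 - x) \<le> t} x \<partial>beta_law z 1)"
      unfolding G_def by (rule nn_integral_indicator[symmetric])
    then show ?thesis
      by (simp add: indicator_def)
  qed
  have G_meas [measurable]: "G t \<in> borel_measurable borel" for t
    unfolding G_ind[abs_def] by measurable
  have cdf: "emeasure (distr (beta_law z 1 \<Otimes>\<^sub>M mu) borel ?h) {..t} = ennreal (t powr z)"
    if t: "0 < t" "t < 1" for t
  proof -
    \<comment> \<open>Split at \<open>u = t\<close>. Below, \<open>u X \<le> t\<close> is almost
      sure. Above, the factor \<open>(t / u)^z\<close> lowers the exponent of the density by
      \<open>z\<close> and leaves a multiple of the tail of \<open>\<beta>(y, 1)\<close>.\<close>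
    have part1: "(\<integral>\<^sup>+u. G t (u, 0) \<partial>beta_law (y + z) 1)
        = ennreal (t powr (y + z) + t powr z * ((y + z) / y) * (1 - t powr y))"
    proof -
      interpret Y: prob_space "beta_law y 1"
        using y by (intro prob_space_beta_law) auto
      have tail: "emeasure (beta_law y 1) {t<..} = ennreal (1 - t powr y)"
      proof -
        have "{t<..} = space (beta_law y 1) - {..t}" by auto
        then have "emeasure (beta_law y 1) {t<..} = 1 - emeasure (beta_law y 1) {..t}"
          unfolding Y.emeasure_space_1[symmetric] by (simp only:) (rule emeasure_compl, auto)
        then show ?thesis
          using t y by (simp add: emeasure_beta_law_1 ennreal_minus flip: ennreal_1)
      qed
      have G1: "G t (u, 0) = ennreal (min 1 (t / u) powr z)" if "0 < u" for u
      proof -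
        have "{x. fst (u, 0) * x + snd (u, 0) * (1 - x) \<le> t} = {..t / u}"
          using that by (auto simp: field_simps)
        then show ?thesis
          using that t z by (simp add: G_def emeasure_beta_law_1)
      qed
      have "(\<integral>\<^sup>+u. G t (u, 0) \<partial>beta_law (y + z) 1)
          = (\<integral>\<^sup>+u. ennreal (beta_density (y + z) 1 u) * G t (u, 0) \<partial>lborel)"
        by (rule nn_integral_beta_law) simp
      also have "\<dots> = (\<integral>\<^sup>+u. ennreal (beta_density (y + z) 1 u) * indicator {..t} u
          + ennreal (t powr z * ((y + z) / y)) * (ennreal (beta_density y 1 u) * indicator {t<..} u) \<partial>lborel)"
      proof (rule nn_integral_cong)
        fix u :: real
        consider "\<not> (0 < u \<and> u < 1)" | "0 < u" "u \<le> t" | "t < u" "0 < u" "u < 1"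
          using t by linarith
        then show "ennreal (beta_density (y + z) 1 u) * G t (u, 0)
          = ennreal (beta_density (y + z) 1 u) * indicator {..t} u
          + ennreal (t powr z * ((y + z) / y)) * (ennreal (beta_density y 1 u) * indicator {t<..} u)"
        proof cases
          case 1
          then have "beta_density c 1 u = 0" for c
            unfolding beta_density_def by (rule if_not_P)
          then show ?thesis by simp
        next
          case 2
          then show ?thesis using t by (simp add: G1)
        next
          case 3
          have "beta_density (y + z) 1 u * (t / u) powr z = t powr z * ((y + z) / y) * beta_density y 1 u"
            using 3 t y z by (simp add: beta_density_def Beta_1_right powr_divide powr_diff powr_add)
          then show ?thesis
            using 3 t y z by (simp add: G1 beta_density_nonneg flip: ennreal_mult)
        qed
      qed
      also have "\<dots> = emeasure (beta_law (y + z) 1) {..t}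
          + ennreal (t powr z * ((y + z) / y)) * emeasure (beta_law y 1) {t<..}"
        by (subst nn_integral_add)
          (auto simp: nn_integral_cmult nn_integral_beta_law simp flip: nn_integral_indicator)
      also have "\<dots> = ennreal (t powr (y + z) + t powr z * ((y + z) / y) * (1 - t powr y))"
      proof -
        have "t powr y \<le> 1" using t y by (simp add: powr_le1)
        then show ?thesis
          unfolding tail using t y z
          by (simp add: emeasure_beta_law_1 flip: ennreal_mult ennreal_plus)
      qed
      finally show ?thesis .
    qed
    \<comment> \<open>The factor \<open>(1 - r)^z\<close> of the density cancels the denominator of
      \<open>((t - r) / (1 - r))^z\<close>. After \<open>r = t w\<close> the density of
      \<open>\<beta>(y, z + 1)\<close> in \<open>w\<close> reappears, with total mass 1.\<close>
    have part2: "(\<integral>\<^sup>+r. G t (1, r) \<partial>beta_law y (z + 1)) = ennreal (t powr (y + z))"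
    proof -
      interpret R: prob_space "beta_law y (z + 1)"
        using y z by (intro prob_space_beta_law) auto
      have G2: "G t (1, r) = (if r < t then ennreal (((t - r) / (1 - r)) powr z) else 0)"
        if "r < 1" for r
      proof -
        have eq: "{x. fst (1, r) * x + snd (1, r) * (1 - x) \<le> t} = {..(t - r) / (1 - r)}"
          using that by (auto simp: field_simps)
        show ?thesis
        proof (cases "r < t")
          case True
          moreover have "min 1 ((t - r) / (1 - r)) = (t - r) / (1 - r)"
            using that t by (simp add: min_def)
          ultimately show ?thesis
            unfolding G_def eq using that z by (simp add: emeasure_beta_law_1)
        next
          case False
          have "emeasure (beta_law z 1) {..(t - r) / (1 - r)} \<le> emeasure (beta_law z 1) {..0}"
            using False that by (intro emeasure_mono) (auto simp: divide_le_0_iff intro: order_trans)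
          then show ?thesis
            unfolding G_def eq using False z by (simp add: emeasure_beta_law_1)
        qed
      qed
      have "(\<integral>\<^sup>+r. G t (1, r) \<partial>beta_law y (z + 1))
          = (\<integral>\<^sup>+r. ennreal (beta_density y (z + 1) r) * G t (1, r) \<partial>lborel)"
        by (rule nn_integral_beta_law) simp
      also have "\<dots> = ennreal \<bar>t\<bar> * (\<integral>\<^sup>+w. ennreal (beta_density y (z + 1) (0 + t * w)) * G t (1, 0 + t * w) \<partial>lborel)"
        by (rule nn_integral_real_affine) (use t in auto)
      also have "\<dots> = (\<integral>\<^sup>+w. ennreal t * (ennreal (beta_density y (z + 1) (t * w)) * G t (1, t * w)) \<partial>lborel)"
        using t by (subst nn_integral_cmult[symmetric]) auto
      also have "\<dots> = (\<integral>\<^sup>+w. ennreal (t powr (y + z)) * ennreal (beta_density y (z + 1) w) \<partial>lborel)"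
      proof (rule nn_integral_cong)
        fix w :: real
        consider "w \<le> 0" | "1 \<le> w" | "0 < w" "w < 1" by linarith
        then show "ennreal t * (ennreal (beta_density y (z + 1) (t * w)) * G t (1, t * w))
            = ennreal (t powr (y + z)) * ennreal (beta_density y (z + 1) w)"
        proof cases
          case 1
          then have "t * w \<le> 0" using t by (simp add: mult_nonneg_nonpos)
          then show ?thesis using 1 by (simp add: beta_density_def)
        next
          case 2
          then have "t \<le> t * w" using t by simp
          \<comment> \<open>Both ways to vanish occur: if \<open>t w < 1\<close> the conditional
            probability is 0, otherwise the density is.\<close>
          moreover have "G t (1, t * w) = 0 \<or> 1 \<le> t * w"
            using G2[of "t * w"] \<open>t \<le> t * w\<close> by (cases "t * w < 1") auto
          ultimately show ?thesis using 2 by (auto simp: beta_density_def)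
        next
          case 3
          then have tw: "0 < t * w" "t * w < t" "t * w < 1"
            using t by (auto intro: less_trans[of "t * w" t])
          have "t * (beta_density y (z + 1) (t * w) * ((t - t * w) / (1 - t * w)) powr z)
              = t powr (y + z) * beta_density y (z + 1) w"
          proof -
            have "t - t * w = t * (1 - w)" by (simp add: algebra_simps)
            then have "(1 - t * w) powr z * ((t - t * w) / (1 - t * w)) powr z = t powr z * (1 - w) powr z"
              using 3 t tw by (simp add: powr_divide powr_mult)
            moreover have "t * (t * w) powr (y - 1) = t powr y * w powr (y - 1)"
              using 3 t by (simp add: powr_mult powr_diff)
            moreover have "beta_density y (z + 1) (t * w)
                = (t * w) powr (y - 1) * (1 - t * w) powr z / Beta y (z + 1)"
              using tw by (simp add: beta_density_def)
            moreover have "beta_density y (z + 1) w = w powr (y - 1) * (1 - w) powr z / Beta y (z + 1)"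
              using 3 by (simp add: beta_density_def)
            ultimately show ?thesis
              by (simp add: powr_add) (metis (no_types, opaque_lifting) mult.assoc mult.left_commute)
          qed
          then show ?thesis
            using t tw y z by (simp add: G2 beta_density_nonneg flip: ennreal_mult)
        qed
      qed
      also have "\<dots> = ennreal (t powr (y + z)) * emeasure (beta_law y (z + 1)) (space (beta_law y (z + 1)))"
        using nn_integral_beta_law[of "\<lambda>_. 1" y "z + 1"] by (subst nn_integral_cmult) auto
      finally show ?thesis
        unfolding R.emeasure_space_1 by simp
    qed
    have "emeasure (distr (beta_law z 1 \<Otimes>\<^sub>M mu) borel ?h) {..t}
        = (\<integral>\<^sup>+w. indicator {..t} (?h w) \<partial>(beta_law z 1 \<Otimes>\<^sub>M mu))"
      by (subst nn_integral_indicator[symmetric], simp, subst nn_integral_distr) auto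
    also have "\<dots> = (\<integral>\<^sup>+ab. \<integral>\<^sup>+x. indicator {..t} (?h (x, ab)) \<partial>beta_law z 1 \<partial>mu)"
      by (subst XM.nn_integral_snd[symmetric]) (auto intro!: measurable_compose[OF h_meas])
    also have "\<dots> = (\<integral>\<^sup>+ab. G t ab \<partial>mu)"
      by (simp add: G_ind split_beta')
    also have "\<dots> = ennreal p * ennreal (t powr (y + z) + t powr z * ((y + z) / y) * (1 - t powr y))
        + ennreal (1 - p) * ennreal (t powr (y + z))"
      by (simp add: nn_integral_mu part1 part2)
    also have "\<dots> = ennreal (p * (t powr (y + z) + t powr z * ((y + z) / y) * (1 - t powr y))
        + (1 - p) * t powr (y + z))"
    proof -
      have "t powr y \<le> 1" using t y by (simp add: powr_le1)
      then show ?thesis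
        using t y z p_bounds by (simp flip: ennreal_mult ennreal_plus)
    qed
    also have "p * (t powr (y + z) + t powr z * ((y + z) / y) * (1 - t powr y))
        + (1 - p) * t powr (y + z) = t powr z"
    proof -
      have one: "p * ((y + z) / y) = 1" using y z by (simp add: p)
      have "p * (t powr z * ((y + z) / y) * (1 - t powr y))
          = p * ((y + z) / y) * (t powr z * (1 - t powr y))"
        by (simp only: mult_ac)
      then have "p * (t powr z * ((y + z) / y) * (1 - t powr y)) = t powr z * (1 - t powr y)"
        unfolding one by simp
      then show ?thesis by (simp add: powr_add algebra_simps)
    qed
    finally show ?thesis .
  qed
  have "distr (beta_law z 1 \<Otimes>\<^sub>M mu) borel ?h = beta_law z 1"
    by (rule beta_law_1_eqI[OF z _ cdf]) (auto intro!: XM.P.real_distribution_distr)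
  then show ?thesis
    using z by (simp add: mix_equation_solution_def real_distribution_beta_law)
qed

text \<open>\<open>beta_gamma_algebra\<close> is used twice: from right to left to write the gamma
  pair as \<open>(X S, (1 - X) S)\<close>, and, after \<open>mix_beta\<close> has been applied at
  each fixed \<open>S = s\<close>, from left to right to recognise \<open>X S\<close>.\<close>

lemma sum_gamma: "sum_equation_solution mu 1 (gamma_law z)"
proof -
  interpret Gz: prob_space "gamma_law z"
    using z by (rule prob_space_gamma_law)
  interpret G1: prob_space "gamma_law 1"
    by (rule prob_space_gamma_law) simp
  interpret X: prob_space "beta_law z 1"
    using z by (intro prob_space_beta_law) auto
  interpret GM: pair_prob_space "gamma_law 1" mu ..
  interpret GGM: pair_prob_space "gamma_law z" "gamma_law 1 \<Otimes>\<^sub>M mu" ..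
  interpret XM: pair_prob_space "beta_law z 1" mu ..
  let ?h = "\<lambda>(v1, v2, A, B). A * v1 + B * v2 :: real"
  have h_meas [measurable]: "?h \<in> borel_measurable (gamma_law z \<Otimes>\<^sub>M (gamma_law 1 \<Otimes>\<^sub>M mu))"
    unfolding split_beta' by measurable
  have g_meas: "(\<lambda>(x, A, B). A * x + B * (1 - x) :: real) \<in> borel_measurable (beta_law z 1 \<Otimes>\<^sub>M mu)"
    unfolding split_beta' by measurable
  have "distr (gamma_law z \<Otimes>\<^sub>M (gamma_law 1 \<Otimes>\<^sub>M mu)) borel ?h = gamma_law z"
  proof (rule measure_eqI)
    fix S assume "S \<in> sets (distr (gamma_law z \<Otimes>\<^sub>M (gamma_law 1 \<Otimes>\<^sub>M mu)) borel ?h)"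
    then have S [measurable]: "S \<in> sets borel" by simp
    \<comment> \<open>The conditional probability of hitting \<open>S\<close> given
      \<open>(V1, V2) = (v1, v2)\<close>.\<close>
    define H :: "real \<Rightarrow> real \<Rightarrow> ennreal"
      where "H v1 v2 = (\<integral>\<^sup>+ab. indicator S (fst ab * v1 + snd ab * v2) \<partial>mu)" for v1 v2
    have H_meas: "case_prod H \<in> borel_measurable (borel \<Otimes>\<^sub>M borel)"
      unfolding H_def[abs_def] split_beta' by measurable
    have "emeasure (distr (gamma_law z \<Otimes>\<^sub>M (gamma_law 1 \<Otimes>\<^sub>M mu)) borel ?h) S
        = (\<integral>\<^sup>+w. indicator S (?h w) \<partial>(gamma_law z \<Otimes>\<^sub>M (gamma_law 1 \<Otimes>\<^sub>M mu)))"
      by (subst nn_integral_indicator[symmetric], simp, subst nn_integral_distr) auto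
    also have "\<dots> = (\<integral>\<^sup>+v1. \<integral>\<^sup>+w. indicator S (?h (v1, w)) \<partial>(gamma_law 1 \<Otimes>\<^sub>M mu) \<partial>gamma_law z)"
      by (rule GM.nn_integral_fst[symmetric]) (auto intro!: measurable_compose[OF h_meas])
    also have "\<dots> = (\<integral>\<^sup>+v1. \<integral>\<^sup>+v2. H v1 v2 \<partial>gamma_law 1 \<partial>gamma_law z)"
    proof (rule nn_integral_cong)
      fix v1 :: real
      show "(\<integral>\<^sup>+w. indicator S (?h (v1, w)) \<partial>(gamma_law 1 \<Otimes>\<^sub>M mu))
          = (\<integral>\<^sup>+v2. H v1 v2 \<partial>gamma_law 1)"
        unfolding H_def by (subst mu.nn_integral_fst[symmetric]) (simp_all add: split_beta')
    qed
    also have "\<dots> = (\<integral>\<^sup>+s. \<integral>\<^sup>+x. H (x * s) ((1 - x) * s) \<partial>beta_law z 1 \<partial>gamma_law (z + 1))"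
      by (rule beta_gamma_algebra[symmetric]) (use z H_meas in auto)
    also have "\<dots> = (\<integral>\<^sup>+s. \<integral>\<^sup>+x. indicator S (x * s) \<partial>beta_law z 1 \<partial>gamma_law (z + 1))"
    proof (rule nn_integral_cong)
      fix s :: real
      have "(\<integral>\<^sup>+x. H (x * s) ((1 - x) * s) \<partial>beta_law z 1)
          = (\<integral>\<^sup>+x. \<integral>\<^sup>+ab. indicator S ((fst ab * x + snd ab * (1 - x)) * s) \<partial>mu \<partial>beta_law z 1)"
        by (simp add: H_def algebra_simps)
      also have "\<dots> = (\<integral>\<^sup>+w. indicator S ((\<lambda>(x, A, B). A * x + B * (1 - x)) w * s) \<partial>(beta_law z 1 \<Otimes>\<^sub>M mu))"
        by (subst mu.nn_integral_fst[symmetric]) (simp_all add: split_beta')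
      also have "\<dots> = (\<integral>\<^sup>+x. indicator S (x * s)
          \<partial>distr (beta_law z 1 \<Otimes>\<^sub>M mu) borel (\<lambda>(x, A, B). A * x + B * (1 - x)))"
        using g_meas by (subst nn_integral_distr) auto
      also have "\<dots> = (\<integral>\<^sup>+x. indicator S (x * s) \<partial>beta_law z 1)"
        using mix_beta by (simp add: mix_equation_solution_def)
      finally show "(\<integral>\<^sup>+x. H (x * s) ((1 - x) * s) \<partial>beta_law z 1)
          = (\<integral>\<^sup>+x. indicator S (x * s) \<partial>beta_law z 1)" .
    qed
    \<comment> \<open>Here the integrand depends on the first coordinate only, and the second
      integrates to total mass 1.\<close>
    also have "\<dots> = (\<integral>\<^sup>+v1. \<integral>\<^sup>+v2. indicator S v1 \<partial>gamma_law 1 \<partial>gamma_law z)"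
      by (rule beta_gamma_algebra) (use z in \<open>auto simp: split_beta'\<close>)
    also have "\<dots> = emeasure (gamma_law z) S"
      by (simp add: G1.emeasure_space_1[simplified])
    finally show "emeasure (distr (gamma_law z \<Otimes>\<^sub>M (gamma_law 1 \<Otimes>\<^sub>M mu)) borel ?h) S
        = emeasure (gamma_law z) S" .
  qed simp
  then show ?thesis
    using z by (simp add: sum_equation_solution_def real_distribution_gamma_law)
qed

section \<open>Both equations as random affine maps over one noise\<close>

abbreviation K :: "((real \<times> real) \<times> real) measure" where
  "K \<equiv> mu \<Otimes>\<^sub>M gamma_law 1"

lemma sets_K: "sets K = sets borel"
proof -
  have "sets K = sets (borel \<Otimes>\<^sub>M borel)"
    by (intro sets_pair_measure_cong) (simp_all add: sets_mu)
  then show ?thesis by (simp only: borel_prod)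
qed

lemma prob_space_K: "prob_space K"
proof -
  interpret G1: prob_space "gamma_law 1"
    by (rule prob_space_gamma_law) simp
  interpret pair_prob_space mu "gamma_law 1" ..
  show ?thesis by unfold_locales
qed

lemma distr_K_fst: "distr K mu fst = mu"
  by (rule prob_space.distr_pair_fst) (simp add: prob_space_gamma_law)

text \<open>The two bounds are chosen to cover the slopes \<open>A\<close> and \<open>A - B\<close>
  and the shift \<open>B\<close> at once.\<close>

lemma
  fixes f :: "real \<times> real \<Rightarrow> real"
  assumes [measurable]: "f \<in> borel_measurable borel"
    and u: "\<And>u. 0 < u \<Longrightarrow> u < 1 \<Longrightarrow> \<bar>f (u, 0)\<bar> \<le> u"
    and r: "\<And>r. 0 < r \<Longrightarrow> r < 1 \<Longrightarrow> \<bar>f (1, r)\<bar> \<le> 1"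
  shows integrable_K: "integrable K (\<lambda>k. f (fst k))"
    and integral_K_less_1: "(\<integral>k. \<bar>f (fst k)\<bar> \<partial>K) < 1"
proof -
  have f_mu: "f \<in> borel_measurable mu"
    using assms(1) by (simp cong: measurable_cong_sets)
  have "(\<integral>\<^sup>+k. ennreal \<bar>f (fst k)\<bar> \<partial>K) = (\<integral>\<^sup>+ab. ennreal \<bar>f ab\<bar> \<partial>distr K mu fst)"
    using f_mu by (subst nn_integral_distr) auto
  also have "\<dots> \<le> ennreal (1 - p / (y + z + 1))"
    unfolding distr_K_fst by (rule nn_integral_mu_le) (use u r in \<open>auto simp: ennreal_leI\<close>)
  finally have le: "(\<integral>\<^sup>+k. ennreal \<bar>f (fst k)\<bar> \<partial>K) \<le> ennreal (1 - p / (y + z + 1))" .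
  have meas [measurable]: "(\<lambda>k. f (fst k)) \<in> borel_measurable K"
    by (rule measurable_compose[OF measurable_fst f_mu])
  show int: "integrable K (\<lambda>k. f (fst k))"
    using le by (intro integrableI_bounded) (auto intro: le_less_trans)
  have "ennreal (\<integral>k. \<bar>f (fst k)\<bar> \<partial>K) \<le> ennreal (1 - p / (y + z + 1))"
    using le int by (subst nn_integral_eq_integral[symmetric]) auto
  moreover have "0 < p / (y + z + 1)" "p / (y + z + 1) \<le> 1"
    using p_bounds y z by simp_all
  ultimately show "(\<integral>k. \<bar>f (fst k)\<bar> \<partial>K) < 1"
    by (simp add: ennreal_le_iff)
qed

text \<open>Uses \<open>A x + B (1 - x) = (A - B) x + B\<close>. The noise is the full triple, so
  that one i.i.d. sequence drives both iterations.\<close>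

sublocale mix: random_affine_map K "\<lambda>k. fst (fst k) - snd (fst k)" "\<lambda>k. snd (fst k)"
proof (intro random_affine_map.intro random_affine_map_axioms.intro)
  show "integrable K (\<lambda>k. fst (fst k) - snd (fst k))"
    by (rule integrable_K[of "\<lambda>ab. fst ab - snd ab"]) auto
  show "(\<integral>k. \<bar>fst (fst k) - snd (fst k)\<bar> \<partial>K) < 1"
    by (rule integral_K_less_1[of "\<lambda>ab. fst ab - snd ab"]) auto
qed (use prob_space_K sets_K in simp_all)

sublocale sum: random_affine_map K "\<lambda>k. fst (fst k)" "\<lambda>k. snd (fst k) * snd k"
proof (intro random_affine_map.intro random_affine_map_axioms.intro)
  show "integrable K (\<lambda>k. fst (fst k))"
    by (rule integrable_K[of "\<lambda>ab. fst ab"]) auto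
  show "(\<integral>k. \<bar>fst (fst k)\<bar> \<partial>K) < 1"
    by (rule integral_K_less_1[of "\<lambda>ab. fst ab"]) auto
qed (use prob_space_K sets_K in simp_all)

text \<open>Since \<open>mu\<close> is the first marginal of \<open>K\<close>, averaging over the
  larger noise yields the same image law.\<close>

lemma mix_equation_iff_push:
  "mix_equation_solution mu \<nu> \<longleftrightarrow> real_distribution \<nu> \<and> mix.push \<nu> = \<nu>"
proof (cases "real_distribution \<nu>")
  case True
  then interpret \<nu>: real_distribution \<nu> .
  have "distr (\<nu> \<Otimes>\<^sub>M mu) borel (\<lambda>(x, A, B). A * x + B * (1 - x))
      = distr (\<nu> \<Otimes>\<^sub>M distr K mu fst) borel (\<lambda>(x, A, B). A * x + B * (1 - x))"
    by (simp only: distr_K_fst)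
  also have "\<dots> = mix.push \<nu>"
    unfolding mix.push_def
    by (subst distr_pair_distr)
      (auto simp: split_beta' algebra_simps \<nu>.prob_space_axioms prob_space_K)
  finally show ?thesis
    by (simp add: mix_equation_solution_def)
qed (simp add: mix_equation_solution_def)

lemma sum_equation_iff_push:
  "sum_equation_solution mu 1 \<nu> \<longleftrightarrow> real_distribution \<nu> \<and> sum.push \<nu> = \<nu>"
proof (cases "real_distribution \<nu>")
  case True
  then interpret \<nu>: real_distribution \<nu> .
  interpret G1: prob_space "gamma_law 1"
    by (rule prob_space_gamma_law) simp
  interpret GM: pair_prob_space "gamma_law 1" mu ..
  \<comment> \<open>The equation lists the gamma variable before \<open>(A, B)\<close> and
    \<open>K\<close> lists it after, hence the swap.\<close>
  have "distr (\<nu> \<Otimes>\<^sub>M (gamma_law 1 \<Otimes>\<^sub>M mu)) borel (\<lambda>(v1, v2, A, B). A * v1 + B * v2)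
      = distr (\<nu> \<Otimes>\<^sub>M distr K (gamma_law 1 \<Otimes>\<^sub>M mu) (\<lambda>(x, y). (y, x))) borel (\<lambda>(v1, v2, A, B). A * v1 + B * v2)"
    by (subst GM.distr_pair_swap) (rule refl)
  also have "\<dots> = sum.push \<nu>"
    unfolding sum.push_def
    by (subst distr_pair_distr)
      (auto simp: split_beta' \<nu>.prob_space_axioms prob_space_K)
  finally show ?thesis
    by (simp add: sum_equation_solution_def)
qed (simp add: sum_equation_solution_def)

lemmas mix_beta_push = conjunct1[OF mix_beta[unfolded mix_equation_iff_push]]
  conjunct2[OF mix_beta[unfolded mix_equation_iff_push]]

lemmas sum_gamma_push = conjunct1[OF sum_gamma[unfolded sum_equation_iff_push]]
  conjunct2[OF sum_gamma[unfolded sum_equation_iff_push]]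

lemma mix_equation_solution_iff: "mix_equation_solution mu \<nu> \<longleftrightarrow> \<nu> = beta_law z 1"
  using mix.fixed_point_unique mix_beta_push by (auto simp: mix_equation_iff_push)

lemma sum_equation_solution_iff: "sum_equation_solution mu 1 \<nu> \<longleftrightarrow> \<nu> = gamma_law z"
  using sum.fixed_point_unique sum_gamma_push by (auto simp: sum_equation_iff_push)

end

theorem theorem3:
  fixes y z p a b :: real
    and N :: "'n measure" and I :: "'n \<Rightarrow> bool" and L R :: "'n \<Rightarrow> real"
    and mu :: "(real \<times> real) measure"
    and M :: "'w measure" and A B V :: "nat \<Rightarrow> 'w \<Rightarrow> real"
    and F G :: "'w \<Rightarrow> nat \<Rightarrow> real \<Rightarrow> real"
  assumes "y > 0" and "z > 0" and "p = y / (y + z)" and "a = z" and "b = 1"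
    and "prob_space N"
    and "distr N (count_space UNIV) I = measure_pmf (bernoulli_pmf p)"
    and "\<forall>\<omega>\<in>space N. L \<omega> \<in> {0..<1} \<and> R \<omega> \<in> {0..<1}"
    and "distr N borel L = beta_law 1 (y + z)"
    and "distr N borel R = beta_law y (z + 1)"
    and "indep_rv N (count_space UNIV) I borel (\<lambda>\<omega>. (L \<omega>, R \<omega>))"
    and "mu = distr N borel (\<lambda>\<omega>. of_bool (I \<omega>) *\<^sub>R (1 - L \<omega>, 0)
                                   + (1 - of_bool (I \<omega>)) *\<^sub>R (1, R \<omega>))"
    and "prob_space M"
    and "prob_space.indep_vars M (\<lambda>_. borel) (\<lambda>n \<omega>. ((A n \<omega>, B n \<omega>), V n \<omega>)) {1..}"
    and "\<forall>n\<ge>1. distr M borel (\<lambda>\<omega>. ((A n \<omega>, B n \<omega>), V n \<omega>)) = mu \<Otimes>\<^sub>M gamma_law b"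
    and "F = (\<lambda>\<omega> n x. A n \<omega> * x + B n \<omega> * (1 - x))"
    and "G = (\<lambda>\<omega> n x'. A n \<omega> * x' + B n \<omega> * V n \<omega>)"
  shows "(\<forall>\<nu>. sum_equation_solution mu b \<nu> \<longleftrightarrow> \<nu> = gamma_law a) \<and>
    (\<forall>\<nu>. mix_equation_solution mu \<nu> \<longleftrightarrow> \<nu> = beta_law a b) \<and>
    (\<exists>Y. Y \<in> borel_measurable M \<and> distr M borel Y = beta_law a b \<and>
      (AE \<omega> in M. uniform_limit {0..1} (\<lambda>n x. backward_iter (F \<omega>) n x) (\<lambda>_. Y \<omega>) sequentially)) \<and>
    (\<forall>x\<in>{0..1}. weak_conv_m (\<lambda>n. distr M borel (\<lambda>\<omega>. forward_iter (F \<omega>) n x)) (beta_law a b)) \<and>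
    (\<forall>x'\<in>{0<..}. weak_conv_m (\<lambda>n. distr M borel (\<lambda>\<omega>. forward_iter (G \<omega>) n x')) (gamma_law a))"
proof -
  have y: "y > 0" and z: "z > 0" and p: "p = y / (y + z)" and a: "a = z" and b: "b = 1"
    and N: "prob_space N" and indepN: "indep_rv N (count_space UNIV) I borel (\<lambda>\<omega>. (L \<omega>, R \<omega>))"
    by fact+
  have LR_meas: "(\<lambda>\<omega>. (L \<omega>, R \<omega>)) \<in> borel_measurable N" and
    I_meas: "I \<in> measurable N (count_space UNIV)"
    using indepN by (auto simp: indep_rv_def)
  have [measurable]: "L \<in> borel_measurable N" "R \<in> borel_measurable N"
    using measurable_compose[OF LR_meas borel_measurable_fst_snd(1)]
      measurable_compose[OF LR_meas borel_measurable_fst_snd(2)] by simp_all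
  have [measurable]: "(\<lambda>\<omega>. of_bool (I \<omega>) :: real) \<in> borel_measurable N"
    by (rule measurable_compose[OF I_meas]) simp
  have AB_meas [measurable]: "(\<lambda>\<omega>. of_bool (I \<omega>) *\<^sub>R (1 - L \<omega>, 0)
      + (1 - of_bool (I \<omega>)) *\<^sub>R (1, R \<omega>)) \<in> borel_measurable N"
    by measurable
  have p01: "0 \<le> p" "p \<le> 1"
    using y z by (simp_all add: p)
  interpret beta_mixture y z p mu
  proof (intro beta_mixture.intro beta_mixture_axioms.intro)
    show "prob_space mu"
      unfolding \<open>mu = _\<close> by (rule prob_space.prob_space_distr[OF N AB_meas])
    show "sets mu = sets borel"
      by (simp add: \<open>mu = _\<close>)
    fix f :: "real \<times> real \<Rightarrow> ennreal" assume f [measurable]: "f \<in> borel_measurable borel"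
    have "(\<integral>\<^sup>+ab. f ab \<partial>mu) = ennreal p * (\<integral>\<^sup>+l. f (1 - l, 0) \<partial>distr N borel L)
        + ennreal (1 - p) * (\<integral>\<^sup>+r. f (1, r) \<partial>distr N borel R)"
      unfolding \<open>mu = _\<close>
      by (subst nn_integral_distr[OF AB_meas])
        (simp, rule nn_integral_bernoulli_mixture[OF N p01 \<open>distr N _ I = _\<close> indepN f])
    \<comment> \<open>Reflection replaces \<open>1 - L\<close> by a variable with law
      \<open>\<beta>(y + z, 1)\<close>.\<close>
    also have "\<dots> = ennreal p * (\<integral>\<^sup>+u. f (u, 0) \<partial>beta_law (y + z) 1)
        + ennreal (1 - p) * (\<integral>\<^sup>+r. f (1, r) \<partial>beta_law y (z + 1))"
      unfolding \<open>distr N borel L = _\<close> \<open>distr N borel R = _\<close>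
      by (subst nn_integral_beta_law_reflect[where f = "\<lambda>u. f (u, 0)"]) auto
    finally show "(\<integral>\<^sup>+ab. f ab \<partial>mu) = ennreal p * (\<integral>\<^sup>+u. f (u, 0) \<partial>beta_law (y + z) 1)
        + ennreal (1 - p) * (\<integral>\<^sup>+r. f (1, r) \<partial>beta_law y (z + 1))" .
  qed fact+
  let ?Z = "\<lambda>n \<omega>. ((A n \<omega>, B n \<omega>), V n \<omega>)"
  have iteration: "random_affine_iteration_axioms K M ?Z"
  proof
    show "prob_space.indep_vars M (\<lambda>_. borel) ?Z {1..}" by fact
    show "distr M borel (?Z n) = K" if "n \<ge> 1" for n
      using that \<open>\<forall>n\<ge>1. _ n\<close> by (simp add: b)
  qed
  interpret mix: random_affine_iteration K "\<lambda>k. fst (fst k) - snd (fst k)" "\<lambda>k. snd (fst k)" M ?Z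
    by (intro random_affine_iteration.intro mix.random_affine_map_axioms iteration) fact
  interpret sum: random_affine_iteration K "\<lambda>k. fst (fst k)" "\<lambda>k. snd (fst k) * snd k" M ?Z
    by (intro random_affine_iteration.intro sum.random_affine_map_axioms iteration) fact
  \<comment> \<open>From here on the iterates of \<open>F\<close> and \<open>G\<close> are literally
    those of the two affine iterations.\<close>
  have F_step: "F \<omega> = mix.step (\<lambda>n. ?Z n \<omega>)" for \<omega>
    by (auto simp: \<open>F = _\<close> mix.step_def fun_eq_iff algebra_simps)
  have G_step: "G \<omega> = sum.step (\<lambda>n. ?Z n \<omega>)" for \<omega>
    by (auto simp: \<open>G = _\<close> sum.step_def fun_eq_iff)
  have "integrable K (\<lambda>k. snd (fst k))"
    by (rule integrable_K[of snd]) auto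
  then obtain Y where "Y \<in> borel_measurable M" "distr M borel Y = beta_law z 1"
    "\<And>S. bounded S \<Longrightarrow> AE \<omega> in M. uniform_limit S (backward_iter (F \<omega>)) (\<lambda>_. Y \<omega>) sequentially"
    unfolding F_step by (rule mix.backward_limit[OF _ mix_beta_push]) blast+
  moreover have "bounded {0..1::real}"
    by simp
  ultimately have "\<exists>Y. Y \<in> borel_measurable M \<and> distr M borel Y = beta_law a b \<and>
      (AE \<omega> in M. uniform_limit {0..1} (\<lambda>n x. backward_iter (F \<omega>) n x) (\<lambda>_. Y \<omega>) sequentially)"
    by (auto simp: a b)
  then show ?thesis
    using mix_equation_solution_iff sum_equation_solution_iff
      mix.forward_weak_conv[OF mix_beta_push] sum.forward_weak_conv[OF sum_gamma_push]
    by (simp add: a b F_step G_step)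
qed

end
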